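(* Assume that the $\xi_n$ are i.i.d. Let $\bar\Lambda_a(t)=\log\mathbb{E}\frac{m_0(t)}{m_0}$ and let $\bar\Lambda_a^*(x)=\sup_{t\in\mathbb{R}}\{xt-\bar\Lambda_a(t)\}$ be its Legendre transform. If $\mathbb{E}\frac{m_0(t)}{m_0}\in(0,\infty)$ for all $t\in\mathbb{R}$, then the sequence of finite measures $A\mapsto\mathbb{E}\frac{Z_n(nA)}{\mathbb{E}_\xi Z_n(\mathbb{R})}$ satisfies a large deviation principle with rate function $\bar\Lambda_a^*$: for each measurable (Borel) subset $A$ of $\mathbb{R}$, $$-\inf_{x\in A^o}\bar\Lambda_a^*(x)\le\liminf_{n\to\infty}\frac1n\log\mathbb{E}\frac{Z_n(nA)}{\mathbb{E}_\xi Z_n(\mathbb{R})}\le\limsup_{n\to\infty}\frac1n\log\mathbb{E}\frac{Z_n(nA)}{\mathbb{E}_\xi Z_n(\mathbb{R})}\le-\inf_{x\in\bar A}\bar\Lambda_a^*(x),$$ where $A^o$ denotes the interior of $A$ and $\bar A$ its closure.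
   Context: Branching random walk in a random environment in time. Let $\xi=(\xi_n)_{n\ge 0}$ be a stationary and ergodic sequence of random variables with values in a measurable space $\Theta$; each realization of $\xi_n$ determines a probability distribution $\eta_n=\eta(\xi_n)$ on $\mathbb{N}\times\mathbb{R}\times\mathbb{R}\times\cdots$. Given $\xi$ (quenched law $\mathbb{P}_\xi$, expectation $\mathbb{E}_\xi$), let $X(u)=(N(u),L_1(u),L_2(u),\dots)$, indexed by finite sequences $u\in\{\emptyset\}\cup\bigcup_{n\ge1}\mathbb{N}^n$, be independent random vectors, $X(u)$ having law $\eta_n$ when the length $|u|$ equals $n$ (values $L_i(u)$ with $i>N(u)$ play no role). The initial particle $\emptyset$ is at $S_\emptyset=0$; each particle $u$ of generation $n$, located at $S_u$, is replaced by $N(u)$ particles $ui$ of generation $n+1$ located at $S_{ui}=S_u+L_i(u)$, $1\le i\le N(u)$. Let $\mathbb{T}_n$ be the set of particles of generation $n$ and $Z_n=\sum_{u\in\mathbb{T}_n}\delta_{S_u}$ their counting measure. The annealed law $\mathbb{P}$ (expectation $\mathbb{E}$) is $\mathbb{P}_\xi$ integrated against the law of $\xi$. Write $N=N(\emptyset)$, $L_i=L_i(\emptyset)$, $m_n=\mathbb{E}_\xi N(u)$ for $|u|=n$, so $\mathbb{E}_\xi Z_n(\mathbb{R})=\prod_{i=0}^{n-1}m_i$. Standing assumption: $\mathbb{E}\log m_0\in(0,\infty)$ and $\mathbb{E}\frac{N}{m_0}\log^+N<\infty$. Notation: $m_0(t)=\mathbb{E}_\xi\sum_{i=1}^{N}e^{tL_i}$,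 so $m_0(0)=m_0$. Also $nA=\{nx:x\in A\}$; $\log0=-\infty$ and $\inf\emptyset=+\infty$. *)

theory Defs
  imports "HOL-Probability.Probability"
begin

(* Values (N, L_1, L_2, ...) of the reproduction vectors.  Positions and children are numbered
   from 0: the component L i of the code is L_(i+1), and the children of u are u @ [i], i < N(u). *)
definition offspring_space :: "(nat \<times> (nat \<Rightarrow> real)) measure" where
  "offspring_space = count_space UNIV \<Otimes>\<^sub>M (\<Pi>\<^sub>M i\<in>UNIV. borel)"

(* The family (X(u)) indexed by all finite sequences u; the length of u is its generation. *)
type_synonym family = "nat list \<Rightarrow> nat \<times> (nat \<Rightarrow> real)"

definition family_space :: "family measure" where
  "family_space = (\<Pi>\<^sub>M u\<in>UNIV. offspring_space)"

definition offspring_number :: "family \<Rightarrow> nat list \<Rightarrow> nat" where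
  "offspring_number X u = fst (X u)"

definition displacement :: "family \<Rightarrow> nat list \<Rightarrow> nat \<Rightarrow> real" where
  "displacement X u i = snd (X u) i"

primrec generation :: "family \<Rightarrow> nat \<Rightarrow> nat list set" where
  "generation X 0 = {[]}"
| "generation X (Suc n) = {u @ [i] | u i. u \<in> generation X n \<and> i < offspring_number X u}"

definition position :: "family \<Rightarrow> nat list \<Rightarrow> real" where
  "position X u = (\<Sum>k<length u. displacement X (take k u) (u ! k))"

lemma position_Nil: "position X [] = 0"
  by (simp add: position_def)

lemma position_snoc: "position X (u @ [i]) = position X u + displacement X u i"
  by (simp add: position_def nth_append)

lemma finite_generation: "finite (generation X n)"
proof (induction n)
  case (Suc n)
  have "generation X (Suc n)
      = (\<Union>u\<in>generation X n. (\<lambda>i. u @ [i]) ` {..<offspring_number X u})"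
    by auto
  with Suc show ?case by simp
qed simp

definition point_count :: "family \<Rightarrow> nat \<Rightarrow> real set \<Rightarrow> ennreal" where
  "point_count X n A = (\<Sum>u\<in>generation X n. indicator A (position X u))"

definition quenched :: "('e \<Rightarrow> (nat \<times> (nat \<Rightarrow> real)) measure) \<Rightarrow> (nat \<Rightarrow> 'e) \<Rightarrow> family measure" where
  "quenched \<eta> e = (\<Pi>\<^sub>M u\<in>UNIV. \<eta> (e (length u)))"

definition environment_law ::
  "'w measure \<Rightarrow> 'e measure \<Rightarrow> (nat \<Rightarrow> 'w \<Rightarrow> 'e) \<Rightarrow> (nat \<Rightarrow> 'e) measure" where
  "environment_law M \<Theta> \<xi> = distr M (\<Pi>\<^sub>M n\<in>UNIV. \<Theta>) (\<lambda>\<omega> n. \<xi> n \<omega>)"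

(* Joint law of (environment, family): the environment has law \<tau>, and given the environment e
   the family has law quenched \<eta> e. *)
definition annealed ::
  "'e measure \<Rightarrow> (nat \<Rightarrow> 'e) measure \<Rightarrow> ('e \<Rightarrow> (nat \<times> (nat \<Rightarrow> real)) measure)
    \<Rightarrow> ((nat \<Rightarrow> 'e) \<times> family) measure" where
  "annealed \<Theta> \<tau> \<eta> =
     \<tau> \<bind> (\<lambda>e. distr (quenched \<eta> e) ((\<Pi>\<^sub>M n\<in>UNIV. \<Theta>) \<Otimes>\<^sub>M family_space) (Pair e))"

definition mean0 :: "('e \<Rightarrow> (nat \<times> (nat \<Rightarrow> real)) measure) \<Rightarrow> (nat \<Rightarrow> 'e) \<Rightarrow> ennreal" where
  "mean0 \<eta> e = (\<integral>\<^sup>+ X. of_nat (offspring_number X []) \<partial>quenched \<eta> e)"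

definition mgf0 :: "('e \<Rightarrow> (nat \<times> (nat \<Rightarrow> real)) measure) \<Rightarrow> (nat \<Rightarrow> 'e) \<Rightarrow> real \<Rightarrow> ennreal" where
  "mgf0 \<eta> e t = (\<integral>\<^sup>+ X. (\<Sum>i<offspring_number X []. ennreal (exp (t * displacement X [] i)))
                  \<partial>quenched \<eta> e)"

lemma mgf0_zero: "mgf0 \<eta> e 0 = mean0 \<eta> e"
  by (simp add: mgf0_def mean0_def)

definition mean_count :: "('e \<Rightarrow> (nat \<times> (nat \<Rightarrow> real)) measure) \<Rightarrow> (nat \<Rightarrow> 'e) \<Rightarrow> nat \<Rightarrow> ennreal" where
  "mean_count \<eta> e n = (\<integral>\<^sup>+ X. point_count X n UNIV \<partial>quenched \<eta> e)"

definition ext_log :: "ennreal \<Rightarrow> ereal" where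
  "ext_log y = (if y = 0 then - \<infinity> else if y = \<infinity> then \<infinity> else ereal (ln (enn2real y)))"

definition log_plus :: "real \<Rightarrow> real" where
  "log_plus y = (if y \<le> 1 then 0 else ln y)"

definition legendre :: "(real \<Rightarrow> ereal) \<Rightarrow> real \<Rightarrow> ereal" where
  "legendre \<Lambda> x = (SUP t. ereal (x * t) - \<Lambda> t)"

definition log_laplace ::
  "((nat \<Rightarrow> 'e) \<times> family) measure \<Rightarrow> ('e \<Rightarrow> (nat \<times> (nat \<Rightarrow> real)) measure) \<Rightarrow> real \<Rightarrow> ereal" where
  "log_laplace P \<eta> t = ext_log (\<integral>\<^sup>+ (e, X). mgf0 \<eta> e t / mean0 \<eta> e \<partial>P)"

definition scaled_mean ::
  "((nat \<Rightarrow> 'e) \<times> family) measure \<Rightarrow> ('e \<Rightarrow> (nat \<times> (nat \<Rightarrow> real)) measure)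
    \<Rightarrow> nat \<Rightarrow> real set \<Rightarrow> ennreal" where
  "scaled_mean P \<eta> n A =
     (\<integral>\<^sup>+ (e, X). point_count X n ((\<lambda>x. real n * x) ` A) / mean_count \<eta> e n \<partial>P)"

(* lower semicontinuous with values in [0, \<infinity>] *)
definition rate_function :: "(real \<Rightarrow> ereal) \<Rightarrow> bool" where
  "rate_function I \<longleftrightarrow> (\<forall>x. 0 \<le> I x) \<and> (\<forall>c. closed {x. I x \<le> c})"

end

(* Peeling off the last generation gives E_xi sum_{u in T_n} exp(t S_u) = prod_{i<n} m_i(t), so by
   independence of the environment the averaged measures mu_n satisfy
   int exp(n t x) mu_n(dx) = M(t)^n with M(t) = E(m_0(t) / m_0).  These transforms alone imply the
   large deviation principle.  Upper bound: a closed set is covered by finitely many half-lines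
   {y. y t - log M(t) > c}, each of mu_n-mass at most exp(-n c).  Lower bound: points
   y = (log M)'(t) are handled by the exponential change of measure; an arbitrary x with finite
   rate is approximated by such points, found by maximising x t - log M(t) - eps t^2 / 2, which
   makes any discussion of steepness or of the range of (log M)' unnecessary. *)
theory Submission
  imports Defs
begin

section \<open>Large deviations from Laplace transforms that are exact powers\<close>

text \<open>The large deviation half knows nothing of branching: it sees \<open>\<mu> n\<close> only
  through its Laplace transform. Because this transform is an exact n-th power and not just
  asymptotically one, the exponential estimates have constants free of n, and smoothness of
  \<open>\<Lambda>\<close> becomes a statement about \<open>\<mu> 1\<close> alone.

  The obstacle in the lower bound is a point x of finite rate where the supremum defining the rate
  is not attained, so that \<open>\<Lambda>\<close> has derivative x nowhere. The penalty \<epsilon>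
  t^2 / 2 is the log-Laplace transform of a centred Gaussian of variance \<epsilon>; adding it to
  \<open>\<Lambda>\<close> forces a maximiser t to exist, and y = x - \<epsilon> t is then a
  derivative. Since y t - \<Lambda> t = (x t - \<Lambda> t) - \<epsilon> t^2, the cost at y
  undercuts the rate at x by at least \<epsilon> t^2. This gain pays for the loss |t| \<delta> of
  working with a ball of radius \<delta> instead of a point.

  On the branching side a generation is a random index set. Sums over it are rewritten as sums over
  all finite sequences with a random weight, so that Tonelli applies.\<close>

lemma ext_log_mono: "a \<le> b \<Longrightarrow> ext_log a \<le> ext_log b"
  by (auto simp: ext_log_def top_unique enn2real_positive_iff less_top zero_less_iff_neq_zero intro!: enn2real_mono)

lemma ext_log_ennreal: "0 < r \<Longrightarrow> ext_log (ennreal r) = ereal (ln r)"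
  by (simp add: ext_log_def)

lemma closed_legendre_sublevel:
  fixes f :: "real \<Rightarrow> real"
  shows "closed {x. legendre (\<lambda>t. ereal (f t)) x \<le> c}"
proof -
  have "{x. legendre (\<lambda>t. ereal (f t)) x \<le> c} = (\<Inter>t. {x. ereal (x * t - f t) \<le> c})"
    by (auto simp: legendre_def SUP_le_iff)
  moreover have "closed {x. ereal (x * t - f t) \<le> c}" for t
    by (intro closed_Collect_le continuous_intros)
  ultimately show ?thesis by (auto intro!: closed_INT)
qed

text \<open>At t = 0 the identity says that \<open>\<mu> n\<close> has total mass one. Index 0 is
  excluded because the points are rescaled by 1 / n.\<close>

locale laplace_sequence =
  fixes \<mu> :: "nat \<Rightarrow> real measure" and M :: "real \<Rightarrow> real"
  assumes sets_\<mu>[measurable_cong]: "\<And>n. sets (\<mu> n) = sets borel"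
    and laplace: "\<And>n t. 1 \<le> n \<Longrightarrow> (\<integral>\<^sup>+x. ennreal (exp (real n * t * x)) \<partial>\<mu> n) = ennreal (M t ^ n)"
    and M_pos: "\<And>t. 0 < M t"
    and M_zero: "M 0 = 1"
begin

definition \<Lambda> :: "real \<Rightarrow> real" where "\<Lambda> t = ln (M t)"
abbreviation rate :: "real \<Rightarrow> ereal" where "rate \<equiv> legendre (\<lambda>t. ereal (\<Lambda> t))"

lemma \<Lambda>_zero: "\<Lambda> 0 = 0"
  by (simp add: \<Lambda>_def M_zero)

lemma rate_ge: "ereal (x * t - \<Lambda> t) \<le> rate x"
  unfolding legendre_def by (rule SUP_upper2[of t]) auto

lemma rate_nonneg: "0 \<le> rate x"
  using rate_ge[of x 0] by (simp add: \<Lambda>_zero zero_ereal_def)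

text \<open>Chernoff bounds dominate indicators by exponentials of affine functions; keeping the
  constant \<open>b\<close> inside lets these be integrated in one step.\<close>

lemma laplace_shift:
  assumes "1 \<le> n"
  shows "(\<integral>\<^sup>+x. ennreal (exp (real n * (t * x + b))) \<partial>\<mu> n) = ennreal (exp (real n * (\<Lambda> t + b)))"
proof -
  have "(\<integral>\<^sup>+x. ennreal (exp (real n * (t * x + b))) \<partial>\<mu> n)
      = (\<integral>\<^sup>+x. ennreal (exp (real n * b)) * ennreal (exp (real n * t * x)) \<partial>\<mu> n)"
    by (simp add: ennreal_mult'[symmetric] exp_add[symmetric] algebra_simps)
  also have "\<dots> = ennreal (exp (real n * b)) * ennreal (M t ^ n)"
    using assms by (simp add: nn_integral_cmult laplace)
  also have "M t ^ n = exp (real n * \<Lambda> t)"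
    using M_pos[of t] by (simp add: exp_of_nat_mult \<Lambda>_def)
  finally show ?thesis
    by (simp add: ennreal_mult'[symmetric] exp_add[symmetric] algebra_simps)
qed

section \<open>Chernoff upper bound for closed sets\<close>

lemma exponential_markov:
  assumes "1 \<le> n" "B \<in> sets borel" and le: "\<And>x. x \<in> B \<Longrightarrow> c \<le> x * t - \<Lambda> t"
  shows "emeasure (\<mu> n) B \<le> ennreal (exp (- real n * c))"
proof -
  have "0 \<le> real n * (t * x + (- \<Lambda> t - c))" if "x \<in> B" for x
    using le[OF that] by (intro mult_nonneg_nonneg) (auto simp: algebra_simps)
  then have pointwise: "indicator B x \<le> ennreal (exp (real n * (t * x + (- \<Lambda> t - c))))" for x
    by (auto simp: indicator_def)
  have "emeasure (\<mu> n) B = (\<integral>\<^sup>+x. indicator B x \<partial>\<mu> n)"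
    using assms by simp
  also have "\<dots> \<le> (\<integral>\<^sup>+x. ennreal (exp (real n * (t * x + (- \<Lambda> t - c)))) \<partial>\<mu> n)"
    by (intro nn_integral_mono pointwise)
  also have "\<dots> = ennreal (exp (- real n * c))"
    using assms by (simp add: laplace_shift)
  finally show ?thesis .
qed

text \<open>Strictness of \<open>c < rate x\<close> yields for each x one t with c < x t - \<Lambda>
  t, an open condition, so compactness leaves finitely many t on a bounded piece. The unbounded rest
  needs only t = 1 and t = -1, because \<open>\<Lambda>\<close> is finite there; this replaces a
  separate exponential tightness argument. The number \<open>k\<close> is the same for all
  n.\<close>

lemma closed_bound:
  assumes F: "closed F" and c: "\<And>x. x \<in> F \<Longrightarrow> ereal c < rate x"
  obtains k :: nat where "0 < k" "\<And>n. 1 \<le> n \<Longrightarrow> emeasure (\<mu> n) F \<le> ennreal (real k * exp (- real n * c))"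
proof -
  define U where "U t = {y. c < y * t - \<Lambda> t}" for t
  have U: "open (U t)" for t
    unfolding U_def by (intro open_Collect_less continuous_intros)
  \<comment> \<open>Large enough that y > K gives c < y - \<Lambda> 1 and y < -K gives c < -y -
    \<Lambda> (-1).\<close>
  define K where "K = \<bar>c\<bar> + \<bar>\<Lambda> 1\<bar> + \<bar>\<Lambda> (-1)\<bar> + 1"
  have "compact (F \<inter> {-K..K})"
    using F by (simp add: closed_Int_compact)
  moreover have "F \<inter> {-K..K} \<subseteq> (\<Union>t\<in>UNIV. U t)"
    using c by (fastforce simp: U_def legendre_def less_SUP_iff)
  ultimately obtain T where T: "finite T" "F \<inter> {-K..K} \<subseteq> (\<Union>t\<in>T. U t)"
    using U by (metis compactE_image)
  define T' where "T' = insert 1 (insert (-1) T)"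
  have "F \<subseteq> (\<Union>t\<in>T'. U t)"
  proof
    fix y assume "y \<in> F"
    show "y \<in> (\<Union>t\<in>T'. U t)"
    proof (cases "y \<in> {-K..K}")
      case True
      then show ?thesis using T \<open>y \<in> F\<close> by (auto simp: T'_def)
    next
      case False
      then have "y \<in> U 1 \<or> y \<in> U (-1)" by (auto simp: U_def K_def)
      then show ?thesis by (auto simp: T'_def)
    qed
  qed
  moreover have "finite T'" using T by (simp add: T'_def)
  ultimately have "emeasure (\<mu> n) F \<le> ennreal (real (card T') * exp (- real n * c))" if "1 \<le> n" for n
  proof -
    have [measurable]: "U t \<in> sets borel" for t using U by simp
    have "emeasure (\<mu> n) F \<le> emeasure (\<mu> n) (\<Union>t\<in>T'. U t)"
      by (rule emeasure_mono) (use \<open>F \<subseteq> _\<close> \<open>finite T'\<close> in auto)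
    also have "\<dots> \<le> (\<Sum>t\<in>T'. emeasure (\<mu> n) (U t))"
      by (rule emeasure_subadditive_finite) (use \<open>finite T'\<close> in auto)
    also have "\<dots> \<le> (\<Sum>t\<in>T'. ennreal (exp (- real n * c)))"
    proof (intro sum_mono)
      show "emeasure (\<mu> n) (U t) \<le> ennreal (exp (- real n * c))" for t
        using that by (rule exponential_markov[where t = t]) (auto simp: U_def)
    qed
    finally show ?thesis by (simp add: ennreal_mult' ennreal_of_nat_eq_real_of_nat)
  qed
  moreover have "0 < card T'" using \<open>finite T'\<close> by (auto simp: card_gt_0_iff T'_def)
  ultimately show ?thesis using that by blast
qed

lemma upper_bound:
  assumes F: "closed F"
  shows "limsup (\<lambda>n. ereal (1 / real n) * ext_log (emeasure (\<mu> n) F)) \<le> - (INF x\<in>F. rate x)"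
proof -
  let ?l = "limsup (\<lambda>n. ereal (1 / real n) * ext_log (emeasure (\<mu> n) F))"
  \<comment> \<open>Real levels strictly below the infimum are tested because the infimum itself may
    be \<infinity>; \<open>dense_le\<close> passes to it at the end.\<close>
  have "ereal c \<le> - ?l" if "ereal c < (INF x\<in>F. rate x)" for c
  proof -
    have "ereal c < rate x" if "x \<in> F" for x
      using \<open>ereal c < _\<close> that by (meson INF_lower less_le_trans)
    then obtain k :: nat where k: "0 < k"
      "\<And>n. 1 \<le> n \<Longrightarrow> emeasure (\<mu> n) F \<le> ennreal (real k * exp (- real n * c))"
      using closed_bound[OF F] by blast
    \<comment> \<open>The number \<open>k\<close> of covering sets enters only as ln k / n, which
      vanishes in the limit.\<close>
    have "eventually (\<lambda>n. ereal (1 / real n) * ext_log (emeasure (\<mu> n) F)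
        \<le> ereal (ln (real k) * (1 / real n) - c)) sequentially"
      using eventually_ge_at_top[of 1]
    proof eventually_elim
      case (elim n)
      have "ext_log (emeasure (\<mu> n) F) \<le> ereal (ln (real k * exp (- real n * c)))"
        using ext_log_mono[OF k(2)[OF elim]] k(1) by (simp add: ext_log_ennreal)
      then have "ereal (1 / real n) * ext_log (emeasure (\<mu> n) F)
          \<le> ereal (1 / real n) * ereal (ln (real k * exp (- real n * c)))"
        by (intro ereal_mult_left_mono) auto
      also have "\<dots> = ereal (ln (real k) * (1 / real n) - c)"
        using k(1) elim by (simp add: ln_mult field_simps)
      finally show ?case .
    qed
    then have "?l \<le> limsup (\<lambda>n. ereal (ln (real k) * (1 / real n) - c))"
      by (rule Limsup_mono)
    also have "(\<lambda>n. ln (real k) * (1 / real n) - c) \<longlonglongrightarrow> ln (real k) * 0 - c"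
      by (intro tendsto_intros lim_1_over_n)
    then have "limsup (\<lambda>n. ereal (ln (real k) * (1 / real n) - c)) = ereal (- c)"
      by (intro lim_imp_Limsup) auto
    finally show ?thesis
      by (cases ?l) auto
  qed
  then have "z \<le> - ?l" if "z < (INF x\<in>F. rate x)" for z
    using that by (cases z) auto
  then have "(INF x\<in>F. rate x) \<le> - ?l"
    by (rule dense_le)
  then show ?thesis
    by (metis ereal_minus_le_minus ereal_uminus_uminus)
qed

section \<open>Differentiability of the logarithmic Laplace transform\<close>

lemma integrable_exp:
  shows "integrable (\<mu> 1) (\<lambda>x. exp (t * x))" and "(\<integral>x. exp (t * x) \<partial>\<mu> 1) = M t"
proof -
  have "(\<integral>\<^sup>+x. ennreal (exp (t * x)) \<partial>\<mu> 1) = ennreal (M t)"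
    using laplace[of 1 t] by simp
  then have "has_bochner_integral (\<mu> 1) (\<lambda>x. exp (t * x)) (M t)"
    using M_pos[of t] by (intro has_bochner_integral_nn_integral) auto
  then show "integrable (\<mu> 1) (\<lambda>x. exp (t * x))" "(\<integral>x. exp (t * x) \<partial>\<mu> 1) = M t"
    by (auto simp: has_bochner_integral_iff)
qed

text \<open>Differentiation under the integral by an explicit remainder: the second order Taylor
  error of exp at t x is at most h^2 times one integrable function, so the difference quotient
  deviates from the candidate derivative by O(|h|).\<close>

lemma M_differentiable: "\<exists>D. (M has_real_derivative D) (at t)"
proof -
  \<comment> \<open>The shift by 2 leaves room for two factors exp |x|: one absorbs x^2 / 2, the
    other the Lagrange factor exp \<theta>, where |\<theta>| \<le> |x|.\<close>
  define g where "g x = exp ((t + 2) * x) + exp ((t - 2) * x)" for x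
  have g_int: "integrable (\<mu> 1) g"
    unfolding g_def by (intro Bochner_Integration.integrable_add integrable_exp)
  have exp_abs: "exp (t * x) * exp (2 * \<bar>x\<bar>) \<le> g x" for x
    by (cases "0 \<le> x") (auto simp: g_def exp_add[symmetric] algebra_simps)
  have rem: "\<bar>exp ((t + h) * x) - exp (t * x) - h * (x * exp (t * x))\<bar> \<le> h\<^sup>2 * g x"
    if "\<bar>h\<bar> \<le> 1" for h x
  proof -
    obtain \<theta> where th: "\<bar>\<theta>\<bar> \<le> \<bar>h * x\<bar>"
      "exp (h * x) = (\<Sum>m<2. (h * x) ^ m / fact m) + exp \<theta> / fact 2 * (h * x) ^ 2"
      using Maclaurin_exp_le[of "h * x" 2] by blast
    have "\<bar>h * x\<bar> \<le> \<bar>x\<bar>"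
      using that by (simp add: abs_mult mult_left_le_one_le)
    then have "exp \<theta> \<le> exp \<bar>x\<bar>" using th(1) by simp
    moreover have "x\<^sup>2 / 2 \<le> exp \<bar>x\<bar>"
      using exp_lower_Taylor_quadratic[of "\<bar>x\<bar>"] by simp
    ultimately have "exp \<theta> * (x\<^sup>2 / 2) \<le> exp \<bar>x\<bar> * exp \<bar>x\<bar>"
      by (intro mult_mono) auto
    then have le: "exp \<theta> * (x\<^sup>2 / 2) \<le> exp (2 * \<bar>x\<bar>)"
      by (simp add: exp_add[symmetric])
    have "exp ((t + h) * x) - exp (t * x) - h * (x * exp (t * x))
        = exp (t * x) * (exp (h * x) - 1 - h * x)"
      by (simp add: algebra_simps exp_add)
    also have "exp (h * x) - 1 - h * x = h\<^sup>2 * (exp \<theta> * (x\<^sup>2 / 2))"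
      unfolding th(2) by (simp add: numeral_2_eq_2 power2_eq_square)
    also have "exp (t * x) * (h\<^sup>2 * (exp \<theta> * (x\<^sup>2 / 2))) = h\<^sup>2 * (exp (t * x) * (exp \<theta> * (x\<^sup>2 / 2)))"
      by simp
    finally have "\<bar>exp ((t + h) * x) - exp (t * x) - h * (x * exp (t * x))\<bar>
        = h\<^sup>2 * (exp (t * x) * (exp \<theta> * (x\<^sup>2 / 2)))"
      by (simp only: abs_of_nonneg mult_nonneg_nonneg zero_le_power2 exp_ge_zero
          zero_le_divide_iff zero_le_numeral simp_thms)
    also have "\<dots> \<le> h\<^sup>2 * (exp (t * x) * exp (2 * \<bar>x\<bar>))"
      using le by (intro mult_left_mono) auto
    also have "\<dots> \<le> h\<^sup>2 * g x"
      using exp_abs[of x] by (intro mult_left_mono) auto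
    finally show ?thesis .
  qed
  have x_int: "integrable (\<mu> 1) (\<lambda>x. x * exp (t * x))"
  proof (rule Bochner_Integration.integrable_bound[OF g_int])
    have "\<bar>x\<bar> * exp (t * x) \<le> g x" for x
    proof -
      have "\<bar>x\<bar> \<le> exp (2 * \<bar>x\<bar>)"
        using exp_ge_add_one_self[of "2 * \<bar>x\<bar>"] by linarith
      then have "exp (t * x) * \<bar>x\<bar> \<le> exp (t * x) * exp (2 * \<bar>x\<bar>)"
        by (intro mult_left_mono) auto
      also note exp_abs[of x]
      finally show ?thesis by (simp only: mult.commute)
    qed
    moreover have "0 \<le> g x" for x by (simp add: g_def)
    ultimately show "AE x in \<mu> 1. norm (x * exp (t * x)) \<le> norm (g x)"
      by (simp add: abs_mult)
  qed simp
  define D where "D = (\<integral>x. x * exp (t * x) \<partial>\<mu> 1)"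
  have bound: "\<bar>(M (t + h) - M t) / h - D\<bar> \<le> \<bar>h\<bar> * (\<integral>x. g x \<partial>\<mu> 1)" if h: "h \<noteq> 0" "\<bar>h\<bar> \<le> 1" for h
  proof -
    have "M (t + h) - M t - h * D
        = (\<integral>x. exp ((t + h) * x) - exp (t * x) - h * (x * exp (t * x)) \<partial>\<mu> 1)"
      using integrable_exp x_int by (simp add: D_def)
    also have "\<bar>\<dots>\<bar> \<le> (\<integral>x. h\<^sup>2 * g x \<partial>\<mu> 1)"
      using rem[OF h(2)] g_int x_int integrable_exp
      by (intro order.trans[OF integral_abs_bound] integral_mono
          Bochner_Integration.integrable_abs Bochner_Integration.integrable_diff
          Bochner_Integration.integrable_mult_right) auto
    finally have "\<bar>M (t + h) - M t - h * D\<bar> \<le> h\<^sup>2 * (\<integral>x. g x \<partial>\<mu> 1)" by simp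
    then have "\<bar>M (t + h) - M t - h * D\<bar> / \<bar>h\<bar> \<le> h\<^sup>2 * (\<integral>x. g x \<partial>\<mu> 1) / \<bar>h\<bar>"
      by (intro divide_right_mono) auto
    also have "\<bar>M (t + h) - M t - h * D\<bar> / \<bar>h\<bar> = \<bar>(M (t + h) - M t) / h - D\<bar>"
      using h by (simp add: abs_divide[symmetric] diff_divide_distrib)
    also have "h\<^sup>2 * (\<integral>x. g x \<partial>\<mu> 1) / \<bar>h\<bar> = \<bar>h\<bar> * (\<integral>x. g x \<partial>\<mu> 1)"
      using h by (simp add: power2_eq_square abs_if)
    finally show ?thesis .
  qed
  have "((\<lambda>h. (M (t + h) - M t) / h - D) \<longlongrightarrow> 0) (at 0)"
  proof (rule Lim_null_comparison)
    show "eventually (\<lambda>h. norm ((M (t + h) - M t) / h - D) \<le> \<bar>h\<bar> * (\<integral>x. g x \<partial>\<mu> 1)) (at 0)"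
      unfolding eventually_at by (intro exI[of _ 1]) (use bound in \<open>auto simp: dist_real_def\<close>)
    show "((\<lambda>h. \<bar>h\<bar> * (\<integral>x. g x \<partial>\<mu> 1)) \<longlongrightarrow> 0) (at 0)"
      by (auto intro!: tendsto_eq_intros)
  qed
  then have "(M has_real_derivative D) (at t)"
    unfolding DERIV_def by (simp add: LIM_zero_iff)
  then show ?thesis by blast
qed

lemma \<Lambda>_differentiable: "\<exists>y. (\<Lambda> has_real_derivative y) (at t)"
proof -
  obtain D where "(M has_real_derivative D) (at t)"
    using M_differentiable by blast
  then have "(\<Lambda> has_real_derivative D / M t) (at t)"
    unfolding \<Lambda>_def[abs_def] using M_pos[of t] by (intro derivative_eq_intros) auto
  then show ?thesis by blast
qed

section \<open>Lower bound for open sets\<close>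

text \<open>This is the change of measure without a tilted measure: the integral of exp (n t x),
  equal to exp (n \<Lambda> t), is split over the ball and its two sides. On the ball the integrand
  is at most exp (n (t y + |t| \<delta>)); the sides contribute an exponentially smaller share. So
  the ball carries most of the integral, which bounds its mass from below.\<close>

lemma ball_lower_bound:
  assumes y: "(\<Lambda> has_real_derivative y) (at t)" and "0 < \<delta>"
  shows "ereal (\<Lambda> t - t * y - \<bar>t\<bar> * \<delta>)
    \<le> liminf (\<lambda>n. ereal (1 / real n) * ext_log (emeasure (\<mu> n) (ball y \<delta>)))"
proof -
  \<comment> \<open>The derivative \<delta> > 0 at t makes a small step to the right strictly
    profitable at slope y + \<delta>; symmetrically to the left at slope y - \<delta>. These are the
    only places where y being the derivative is used.\<close>
  have "((\<lambda>u. (y + \<delta>) * u - \<Lambda> u) has_real_derivative \<delta>) (at t)"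
    by (auto intro!: derivative_eq_intros y)
  from has_real_derivative_pos_inc_right[OF this \<open>0 < \<delta>\<close>] obtain d1 where d1: "d1 > 0"
    "\<And>h. 0 < h \<Longrightarrow> h < d1 \<Longrightarrow> (y + \<delta>) * t - \<Lambda> t < (y + \<delta>) * (t + h) - \<Lambda> (t + h)"
    by auto
  have "((\<lambda>u. (y - \<delta>) * u - \<Lambda> u) has_real_derivative - \<delta>) (at t)"
    by (auto intro!: derivative_eq_intros y)
  from has_real_derivative_neg_dec_left[OF this] \<open>0 < \<delta>\<close> obtain d2 where d2: "d2 > 0"
    "\<And>h. 0 < h \<Longrightarrow> h < d2 \<Longrightarrow> (y - \<delta>) * t - \<Lambda> t < (y - \<delta>) * (t - h) - \<Lambda> (t - h)"
    by auto
  define s where "s = min d1 d2 / 2"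
  have s: "0 < s" "s < d1" "s < d2" using d1(1) d2(1) by (auto simp: s_def)
  \<comment> \<open>\<open>a\<close> and \<open>b\<close> are the exponential rates of the right and
    left tail relative to exp (n \<Lambda> t); the choice of \<open>s\<close> makes both
    negative.\<close>
  define a where "a = \<Lambda> (t + s) - s * (y + \<delta>) - \<Lambda> t"
  define b where "b = \<Lambda> (t - s) + s * (y - \<delta>) - \<Lambda> t"
  have ab: "a < 0" "b < 0"
    using d1(2)[OF s(1,2)] d2(2)[OF s(1,3)] by (auto simp: a_def b_def algebra_simps)
  have split: "exp (real n * \<Lambda> t) \<le> exp (real n * (t * y + \<bar>t\<bar> * \<delta>)) * enn2real (emeasure (\<mu> n) (ball y \<delta>))
      + (exp (real n * (\<Lambda> t + a)) + exp (real n * (\<Lambda> t + b)))"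
    if n: "1 \<le> n" and fin: "emeasure (\<mu> n) (ball y \<delta>) < \<infinity>" for n
  proof -
    let ?k = "exp (real n * (t * y + \<bar>t\<bar> * \<delta>))"
    have [measurable]: "ball y \<delta> \<in> sets borel" by simp
    \<comment> \<open>The last two terms are Chernoff bounds for the tails to the right and to the left of the ball
      under the measure tilted by \<open>exp (n * t * x)\<close>.\<close>
    have pointwise: "ennreal (exp (real n * (t * x + 0))) \<le> ennreal ?k * indicator (ball y \<delta>) x
        + (ennreal (exp (real n * ((t + s) * x + (- s * (y + \<delta>)))))
          + ennreal (exp (real n * ((t - s) * x + s * (y - \<delta>)))))" for x
    proof -
      consider "x \<in> ball y \<delta>" | "y + \<delta> \<le> x" | "x \<le> y - \<delta>"
        by (fastforce simp: dist_real_def abs_less_iff)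
      then show ?thesis
      proof cases
        case 1
        have "t * (x - y) \<le> \<bar>t\<bar> * \<bar>x - y\<bar>" by (metis abs_ge_self abs_mult)
        also have "\<dots> \<le> \<bar>t\<bar> * \<delta>" using 1 by (intro mult_left_mono) (auto simp: dist_real_def)
        finally have "t * x + 0 \<le> t * y + \<bar>t\<bar> * \<delta>" by (simp add: algebra_simps)
        then have "ennreal (exp (real n * (t * x + 0))) \<le> ennreal ?k"
          by (intro ennreal_leI) (simp add: mult_left_mono)
        with 1 show ?thesis by (simp add: add_increasing2)
      next
        case 2
        then have "s * (y + \<delta>) \<le> s * x" using s by (intro mult_left_mono) auto
        then have "t * x + 0 \<le> (t + s) * x + (- s * (y + \<delta>))" by (simp add: algebra_simps)
        then have "ennreal (exp (real n * (t * x + 0))) \<le> ennreal (exp (real n * ((t + s) * x + (- s * (y + \<delta>)))))"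
          by (intro ennreal_leI) (simp only: exp_le_cancel_iff mult_left_mono of_nat_0_le_iff)
        then show ?thesis by (intro add_increasing add_increasing2) auto
      next
        case 3
        then have "s * x \<le> s * (y - \<delta>)" using s by (intro mult_left_mono) auto
        then have "t * x + 0 \<le> (t - s) * x + s * (y - \<delta>)" by (simp add: algebra_simps)
        then have "ennreal (exp (real n * (t * x + 0))) \<le> ennreal (exp (real n * ((t - s) * x + s * (y - \<delta>))))"
          by (intro ennreal_leI) (simp only: exp_le_cancel_iff mult_left_mono of_nat_0_le_iff)
        then show ?thesis by (intro add_increasing) auto
      qed
    qed
    have "ennreal (exp (real n * \<Lambda> t)) = (\<integral>\<^sup>+x. ennreal (exp (real n * (t * x + 0))) \<partial>\<mu> n)"
      using laplace_shift[OF n, of t 0] by simp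
    also have "\<dots> \<le> (\<integral>\<^sup>+x. ennreal ?k * indicator (ball y \<delta>) x
        + (ennreal (exp (real n * ((t + s) * x + (- s * (y + \<delta>)))))
          + ennreal (exp (real n * ((t - s) * x + s * (y - \<delta>))))) \<partial>\<mu> n)"
      by (intro nn_integral_mono pointwise)
    also have "\<dots> = ennreal ?k * emeasure (\<mu> n) (ball y \<delta>)
        + (ennreal (exp (real n * (\<Lambda> t + a))) + ennreal (exp (real n * (\<Lambda> t + b))))"
    proof -
      have "(\<integral>\<^sup>+x. ennreal ?k * indicator (ball y \<delta>) x \<partial>\<mu> n) = ennreal ?k * emeasure (\<mu> n) (ball y \<delta>)"
        by (intro nn_integral_cmult_indicator) auto
      moreover have "(\<integral>\<^sup>+x. ennreal (exp (real n * ((t + s) * x + (- s * (y + \<delta>))))) \<partial>\<mu> n)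
          = ennreal (exp (real n * (\<Lambda> t + a)))"
        using n by (subst laplace_shift) (auto simp: a_def algebra_simps)
      moreover have "(\<integral>\<^sup>+x. ennreal (exp (real n * ((t - s) * x + s * (y - \<delta>)))) \<partial>\<mu> n)
          = ennreal (exp (real n * (\<Lambda> t + b)))"
        using n by (subst laplace_shift) (auto simp: b_def algebra_simps)
      moreover have "(\<lambda>x. ennreal ?k * indicator (ball y \<delta>) x) \<in> borel_measurable (\<mu> n)"
        "(\<lambda>x. ennreal (exp (real n * ((t + s) * x + (- s * (y + \<delta>)))))) \<in> borel_measurable (\<mu> n)"
        "(\<lambda>x. ennreal (exp (real n * ((t - s) * x + s * (y - \<delta>))))) \<in> borel_measurable (\<mu> n)"
        by measurable
      ultimately show ?thesis
        by (simp only: nn_integral_add borel_measurable_add)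
    qed
    also have "\<dots> = ennreal (?k * enn2real (emeasure (\<mu> n) (ball y \<delta>))
        + (exp (real n * (\<Lambda> t + a)) + exp (real n * (\<Lambda> t + b))))"
      using fin by (simp add: ennreal_mult')
    finally show ?thesis
      by (subst (asm) ennreal_le_iff) auto
  qed
  have lim: "(\<lambda>n. exp c ^ n) \<longlonglongrightarrow> 0" if "c < 0" for c :: real
    using that by (intro LIMSEQ_power_zero) simp
  have "(\<lambda>n. exp a ^ n + exp b ^ n) \<longlonglongrightarrow> 0 + 0"
    by (intro tendsto_add lim ab)
  \<comment> \<open>From here on the tails take at most half of the integral. The lost factor 1 / 2
    costs ln (1 / 2) / n, which vanishes.\<close>
  then have "eventually (\<lambda>n. exp a ^ n + exp b ^ n < 1 / 2) sequentially"
    by (intro order_tendstoD) auto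
  then have "eventually (\<lambda>n. ereal ((\<Lambda> t - t * y - \<bar>t\<bar> * \<delta>) + ln (1 / 2) * (1 / real n))
      \<le> ereal (1 / real n) * ext_log (emeasure (\<mu> n) (ball y \<delta>))) sequentially"
    using eventually_ge_at_top[of 1]
  proof eventually_elim
    case (elim n)
    show ?case
    proof (cases "emeasure (\<mu> n) (ball y \<delta>) < \<infinity>")
      case False
      then have "ext_log (emeasure (\<mu> n) (ball y \<delta>)) = \<infinity>"
        by (simp add: ext_log_def not_less top_unique)
      then show ?thesis using elim by simp
    next
      case True
      let ?m = "enn2real (emeasure (\<mu> n) (ball y \<delta>))"
      let ?k = "exp (real n * (t * y + \<bar>t\<bar> * \<delta>))"
      have "exp (real n * (\<Lambda> t + a)) + exp (real n * (\<Lambda> t + b))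
          = exp (real n * \<Lambda> t) * (exp a ^ n + exp b ^ n)"
        by (simp add: exp_of_nat_mult[symmetric] exp_add algebra_simps)
      also have "\<dots> \<le> exp (real n * \<Lambda> t) * (1 / 2)"
        using elim by (intro mult_left_mono) auto
      finally have "exp (real n * \<Lambda> t) * (1 / 2) \<le> ?k * ?m"
        using split[OF elim(2) True] by linarith
      then have "exp (real n * \<Lambda> t) * (1 / 2) / ?k \<le> ?m"
        by (simp add: field_simps)
      moreover have "exp (real n * (\<Lambda> t - t * y - \<bar>t\<bar> * \<delta>)) = exp (real n * \<Lambda> t) / ?k"
        by (simp add: exp_diff[symmetric] right_diff_distrib distrib_left)
      ultimately have m: "1 / 2 * exp (real n * (\<Lambda> t - t * y - \<bar>t\<bar> * \<delta>)) \<le> ?m"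
        by simp
      then have "ennreal (1 / 2 * exp (real n * (\<Lambda> t - t * y - \<bar>t\<bar> * \<delta>))) \<le> emeasure (\<mu> n) (ball y \<delta>)"
        using True by (metis ennreal_enn2real ennreal_leI infinity_ennreal_def)
      from ext_log_mono[OF this]
      have "ereal (ln (1 / 2 * exp (real n * (\<Lambda> t - t * y - \<bar>t\<bar> * \<delta>)))) \<le> ext_log (emeasure (\<mu> n) (ball y \<delta>))"
        by (subst (asm) ext_log_ennreal) auto
      then have "ereal (1 / real n) * ereal (ln (1 / 2 * exp (real n * (\<Lambda> t - t * y - \<bar>t\<bar> * \<delta>))))
          \<le> ereal (1 / real n) * ext_log (emeasure (\<mu> n) (ball y \<delta>))"
        by (intro ereal_mult_left_mono) auto
      moreover have "(\<Lambda> t - t * y - \<bar>t\<bar> * \<delta>) + ln (1 / 2) * (1 / real n)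
          = 1 / real n * ln (1 / 2 * exp (real n * (\<Lambda> t - t * y - \<bar>t\<bar> * \<delta>)))"
        using elim by (subst ln_mult) (auto simp: field_simps)
      ultimately show ?thesis by simp
    qed
  qed
  then have "liminf (\<lambda>n. ereal ((\<Lambda> t - t * y - \<bar>t\<bar> * \<delta>) + ln (1 / 2) * (1 / real n)))
      \<le> liminf (\<lambda>n. ereal (1 / real n) * ext_log (emeasure (\<mu> n) (ball y \<delta>)))"
    by (rule Liminf_mono)
  moreover have "(\<lambda>n. (\<Lambda> t - t * y - \<bar>t\<bar> * \<delta>) + ln (1 / 2) * (1 / real n))
      \<longlonglongrightarrow> (\<Lambda> t - t * y - \<bar>t\<bar> * \<delta>) + ln (1 / 2) * 0"
    by (intro tendsto_intros lim_1_over_n)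
  then have "liminf (\<lambda>n. ereal ((\<Lambda> t - t * y - \<bar>t\<bar> * \<delta>) + ln (1 / 2) * (1 / real n)))
      = ereal (\<Lambda> t - t * y - \<bar>t\<bar> * \<delta>)"
    by (intro lim_imp_Liminf) auto
  ultimately show ?thesis by simp
qed

text \<open>The quadratic penalty confines the maximisation to a compact interval. At the maximiser
  the derivative vanishes, which identifies \<Lambda>' as x - \<epsilon> t; comparison with the
  value 0 at u = 0 gives \<epsilon> t^2 / 2 \<le> x t - \<Lambda> t \<le> r, which makes the
  displacement \<epsilon> t small with \<epsilon>.\<close>

lemma penalised_maximum:
  assumes r: "rate x \<le> ereal r" and "0 < \<epsilon>"
  obtains t where "(\<Lambda> has_real_derivative (x - \<epsilon> * t)) (at t)" "(\<epsilon> * t)\<^sup>2 \<le> 2 * \<epsilon> * r"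
proof -
  define \<phi> where "\<phi> u = x * u - \<Lambda> u - \<epsilon> * u\<^sup>2 / 2" for u
  have le_r: "x * u - \<Lambda> u \<le> r" for u
    using order.trans[OF rate_ge r] by simp
  have "0 \<le> r" using le_r[of 0] by (simp add: \<Lambda>_zero)
  have "isCont \<Lambda> u" for u
    using \<Lambda>_differentiable DERIV_isCont by blast
  then have "isCont \<phi> u" for u
    unfolding \<phi>_def by (intro continuous_intros) auto
  then have cont: "continuous_on {-R..R} \<phi>" for R
    using continuous_at_imp_continuous_on by blast
  \<comment> \<open>For |u| > R the penalty is at least \<epsilon> R / 2 > r, so
    \<open>\<phi>\<close> is negative there while \<open>\<phi> 0 = 0\<close>. The summand 1 gives
    both strictness and R \<ge> 1, hence u^2 \<ge> R.\<close>
  define R where "R = 2 * r / \<epsilon> + 1"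
  have R: "1 \<le> R" "r < \<epsilon> * R / 2"
    using \<open>0 \<le> r\<close> \<open>0 < \<epsilon>\<close> by (auto simp: R_def field_simps)
  have \<phi>_out: "\<phi> u < 0" if "u \<notin> {-R..R}" for u
  proof -
    have "R \<le> \<bar>u\<bar>" "1 \<le> \<bar>u\<bar>" using that R by auto
    then have "R * 1 \<le> \<bar>u\<bar> * \<bar>u\<bar>" using R by (intro mult_mono) auto
    then have "\<epsilon> * R \<le> \<epsilon> * u\<^sup>2" using \<open>0 < \<epsilon>\<close> by (simp add: power2_eq_square)
    with R(2) le_r[of u] show ?thesis by (simp add: \<phi>_def)
  qed
  obtain t where t: "t \<in> {-R..R}" "\<And>u. u \<in> {-R..R} \<Longrightarrow> \<phi> u \<le> \<phi> t"
    using continuous_attains_sup[OF _ _ cont, of R] R by auto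
  have "\<phi> 0 = 0" by (simp add: \<phi>_def \<Lambda>_zero)
  then have "0 \<le> \<phi> t" using t(2)[of 0] R by auto
  then have max: "\<phi> u \<le> \<phi> t" for u
    using \<phi>_out[of u] t(2)[of u] by (cases "u \<in> {-R..R}") auto
  obtain y where y: "(\<Lambda> has_real_derivative y) (at t)"
    using \<Lambda>_differentiable by blast
  then have "(\<phi> has_real_derivative (x - y - \<epsilon> * t)) (at t)"
    unfolding \<phi>_def by (auto intro!: derivative_eq_intros)
  then have "x - y - \<epsilon> * t = 0"
    by (rule DERIV_local_max[where d = 1]) (auto simp: max)
  then have "y = x - \<epsilon> * t" by simp
  moreover have "\<epsilon> * t\<^sup>2 \<le> 2 * r"
    using \<open>0 \<le> \<phi> t\<close> le_r[of t] by (simp add: \<phi>_def)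
  then have "\<epsilon> * (\<epsilon> * t\<^sup>2) \<le> \<epsilon> * (2 * r)"
    using \<open>0 < \<epsilon>\<close> by (intro mult_left_mono) auto
  then have "(\<epsilon> * t)\<^sup>2 \<le> 2 * \<epsilon> * r"
    by (simp add: power2_eq_square algebra_simps)
  ultimately show ?thesis
    using y that by blast
qed

lemma lower_bound:
  assumes G: "open G"
  shows "- (INF x\<in>G. rate x) \<le> liminf (\<lambda>n. ereal (1 / real n) * ext_log (emeasure (\<mu> n) G))"
proof -
  let ?l = "liminf (\<lambda>n. ereal (1 / real n) * ext_log (emeasure (\<mu> n) G))"
  have "- ?l \<le> rate x" if "x \<in> G" for x
  proof (cases "rate x")
    case (real r)
    then have "0 \<le> r" using rate_nonneg[of x] by simp
    obtain d where d: "0 < d" "ball x d \<subseteq> G"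
      using G \<open>x \<in> G\<close> by (meson openE)
    \<comment> \<open>Makes 2 \<epsilon> r < (d / 2)^2, so the approximating point x - \<epsilon> t
      lies within d / 2 of x. Using r + 1 avoids dividing by zero when r = 0.\<close>
    define \<epsilon> where "\<epsilon> = (d / 2)\<^sup>2 / (2 * (r + 1))"
    have \<epsilon>: "0 < \<epsilon>" "2 * \<epsilon> * r < (d / 2)\<^sup>2"
      using \<open>0 \<le> r\<close> d(1) by (auto simp: \<epsilon>_def field_simps)
    obtain t where t: "(\<Lambda> has_real_derivative (x - \<epsilon> * t)) (at t)" "(\<epsilon> * t)\<^sup>2 \<le> 2 * \<epsilon> * r"
      using penalised_maximum[of x r \<epsilon>] real \<epsilon>(1) by auto
    have "\<bar>\<epsilon> * t\<bar> < d / 2"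
    proof (rule power2_less_imp_less)
      show "\<bar>\<epsilon> * t\<bar>\<^sup>2 < (d / 2)\<^sup>2"
        using t(2) \<epsilon>(2) by (simp only: power2_abs)
    qed (use d(1) in simp)
    \<comment> \<open>With \<delta> \<le> \<epsilon> |t| the loss |t| \<delta> is covered by the
      gain \<epsilon> t^2. For t = 0 there is no loss, and \<delta> only has to be positive and at
      most d / 2.\<close>
    define \<delta> where "\<delta> = (if t = 0 then d / 2 else min (d / 2) (\<epsilon> * \<bar>t\<bar>))"
    have \<delta>: "0 < \<delta>" "\<delta> \<le> d / 2" "\<bar>t\<bar> * \<delta> \<le> \<epsilon> * t\<^sup>2"
    proof -
      show "0 < \<delta>" "\<delta> \<le> d / 2" using d(1) \<epsilon>(1) by (auto simp: \<delta>_def)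
      have "\<bar>t\<bar> * \<delta> \<le> \<bar>t\<bar> * (\<epsilon> * \<bar>t\<bar>)"
        by (cases "t = 0") (auto simp: \<delta>_def intro!: mult_left_mono)
      then show "\<bar>t\<bar> * \<delta> \<le> \<epsilon> * t\<^sup>2" by (simp add: power2_eq_square algebra_simps)
    qed
    have "ball (x - \<epsilon> * t) \<delta> \<subseteq> ball x d"
    proof
      fix z assume "z \<in> ball (x - \<epsilon> * t) \<delta>"
      then have "\<bar>x - \<epsilon> * t - z\<bar> < d / 2" using \<delta>(2) by (simp add: dist_real_def)
      with \<open>\<bar>\<epsilon> * t\<bar> < d / 2\<close> have "\<bar>x - z\<bar> < d" by linarith
      then show "z \<in> ball x d" by (simp add: dist_real_def)
    qed
    then have sub: "ball (x - \<epsilon> * t) \<delta> \<subseteq> G" using d(2) by blast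
    have "x * t - \<Lambda> t \<le> r" using rate_ge[of x t] real by simp
    then have "- r \<le> \<Lambda> t - t * (x - \<epsilon> * t) - \<bar>t\<bar> * \<delta>"
      using \<delta>(3) by (simp add: power2_eq_square algebra_simps)
    then have "ereal (- r) \<le> ereal (\<Lambda> t - t * (x - \<epsilon> * t) - \<bar>t\<bar> * \<delta>)" by simp
    also have "\<dots> \<le> liminf (\<lambda>n. ereal (1 / real n) * ext_log (emeasure (\<mu> n) (ball (x - \<epsilon> * t) \<delta>)))"
      by (rule ball_lower_bound[OF t(1) \<delta>(1)])
    also have "\<dots> \<le> ?l"
      using G sub
      by (intro Liminf_mono always_eventually allI ereal_mult_left_mono ext_log_mono emeasure_mono) auto
    finally show ?thesis
      using real ereal_uminus_le_reorder by fastforce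
  qed (use rate_nonneg[of x] in auto)
  then have "- ?l \<le> (INF x\<in>G. rate x)" by (rule INF_greatest)
  then show ?thesis using ereal_uminus_le_reorder by blast
qed

theorem large_deviation_principle:
  assumes "A \<in> sets borel"
  shows "- (INF x\<in>interior A. rate x) \<le> liminf (\<lambda>n. ereal (1 / real n) * ext_log (emeasure (\<mu> n) A))"
    and "limsup (\<lambda>n. ereal (1 / real n) * ext_log (emeasure (\<mu> n) A)) \<le> - (INF x\<in>closure A. rate x)"
proof -
  note mono = always_eventually allI ereal_mult_left_mono ext_log_mono emeasure_mono
  have "liminf (\<lambda>n. ereal (1 / real n) * ext_log (emeasure (\<mu> n) (interior A)))
      \<le> liminf (\<lambda>n. ereal (1 / real n) * ext_log (emeasure (\<mu> n) A))"
    using assms interior_subset[of A] by (intro Liminf_mono mono) auto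
  with lower_bound[OF open_interior]
  show "- (INF x\<in>interior A. rate x) \<le> liminf (\<lambda>n. ereal (1 / real n) * ext_log (emeasure (\<mu> n) A))"
    by (rule order.trans)
  have "limsup (\<lambda>n. ereal (1 / real n) * ext_log (emeasure (\<mu> n) A))
      \<le> limsup (\<lambda>n. ereal (1 / real n) * ext_log (emeasure (\<mu> n) (closure A)))"
    using closure_subset[of A] by (intro Limsup_mono mono) auto
  from this upper_bound[OF closed_closure]
  show "limsup (\<lambda>n. ereal (1 / real n) * ext_log (emeasure (\<mu> n) A)) \<le> - (INF x\<in>closure A. rate x)"
    by (rule order.trans)
qed

lemma rate_function_rate: "rate_function rate"
  using rate_nonneg closed_legendre_sublevel by (simp add: rate_function_def)

end

section \<open>Laplace transforms of the branching random walk\<close>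

text \<open>Resampling one coordinate of an infinite product leaves its law unchanged; this stands in for
  all independence arguments below.\<close>
lemma nn_integral_PiM_update:
  fixes M :: "'i \<Rightarrow> 'a measure"
  assumes M: "\<And>i. prob_space (M i)" and f: "f \<in> borel_measurable (PiM UNIV M)"
  shows "(\<integral>\<^sup>+X. f X \<partial>PiM UNIV M) = (\<integral>\<^sup>+x. \<integral>\<^sup>+X. f (X(j := x)) \<partial>PiM UNIV M \<partial>M j)"
proof -
  have upd: "(\<lambda>(x, X). X(j := x)) \<in> measurable (M j \<Otimes>\<^sub>M PiM UNIV M) (PiM UNIV M)"
    using measurable_comp[OF measurable_pair_swap' measurable_add_dim[of j UNIV M]]
    by (simp add: comp_def case_prod_beta')
  interpret prob_space "PiM UNIV M" by (rule prob_space_PiM) (rule M)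
  have "(\<integral>\<^sup>+X. f X \<partial>PiM UNIV M)
      = (\<integral>\<^sup>+X. f X \<partial>distr (M j \<Otimes>\<^sub>M PiM UNIV M) (PiM UNIV M) (\<lambda>(x, X). X(j := x)))"
    using distr_pair_PiM_eq_PiM[of UNIV M j] M by simp
  also have "\<dots> = (\<integral>\<^sup>+z. f (case z of (x, X) \<Rightarrow> X(j := x)) \<partial>(M j \<Otimes>\<^sub>M PiM UNIV M))"
    by (rule nn_integral_distr[OF upd]) (simp add: f)
  also have "\<dots> = (\<integral>\<^sup>+x. \<integral>\<^sup>+X. f (X(j := x)) \<partial>PiM UNIV M \<partial>M j)"
    using nn_integral_fst[OF measurable_comp[OF upd f, unfolded comp_def]] by simp
  finally show ?thesis .
qed

text \<open>Resampling coordinate \<open>n\<close> splits off the last factor, because the first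
  \<open>n\<close> factors do not read it.\<close>

lemma nn_integral_PiM_prod:
  fixes Q :: "'a measure"
  assumes Q: "prob_space Q" and h[measurable]: "h \<in> borel_measurable Q"
  shows "(\<integral>\<^sup>+e. (\<Prod>i<n. h (e i)) \<partial>PiM (UNIV :: nat set) (\<lambda>_. Q)) = (\<integral>\<^sup>+x. h x \<partial>Q) ^ n"
proof (induction n)
  case 0
  interpret prob_space "PiM (UNIV :: nat set) (\<lambda>_. Q)"
    by (rule prob_space_PiM) (rule Q)
  show ?case by (simp add: emeasure_space_1)
next
  case (Suc n)
  have "(\<integral>\<^sup>+e. (\<Prod>i<Suc n. h (e i)) \<partial>PiM UNIV (\<lambda>_. Q))
      = (\<integral>\<^sup>+x. \<integral>\<^sup>+e. (\<Prod>i<Suc n. h ((e(n := x)) i)) \<partial>PiM UNIV (\<lambda>_. Q) \<partial>Q)"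
    by (rule nn_integral_PiM_update[OF Q]) measurable
  also have "\<dots> = (\<integral>\<^sup>+x. \<integral>\<^sup>+e. h x * (\<Prod>i<n. h (e i)) \<partial>PiM UNIV (\<lambda>_. Q) \<partial>Q)"
    by (simp add: mult.commute)
  also have "\<dots> = (\<integral>\<^sup>+x. h x * (\<integral>\<^sup>+x. h x \<partial>Q) ^ n \<partial>Q)"
    by (subst nn_integral_cmult) (simp_all add: Suc.IH)
  also have "\<dots> = (\<integral>\<^sup>+x. h x \<partial>Q) ^ Suc n"
    by (simp add: nn_integral_multc)
  finally show ?case .
qed

section \<open>Measurability and structure of the generations\<close>

lemma measurable_fst_offspring[measurable]: "fst \<in> measurable offspring_space (count_space UNIV)"
  by (simp add: offspring_space_def)

lemma measurable_snd_offspring[measurable]: "(\<lambda>y. snd y i) \<in> borel_measurable offspring_space"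
  unfolding offspring_space_def by measurable

lemma measurable_family_component[measurable]: "(\<lambda>X. X u) \<in> measurable family_space offspring_space"
  unfolding family_space_def by measurable

lemma measurable_offspring_number[measurable]:
  "(\<lambda>X. offspring_number X u) \<in> measurable family_space (count_space UNIV)"
  unfolding offspring_number_def by measurable

lemma measurable_position[measurable]: "(\<lambda>X. position X u) \<in> borel_measurable family_space"
  unfolding position_def displacement_def by measurable

text \<open>Without the recursion, membership becomes finitely many conditions on \<open>X\<close>
  at proper prefixes of \<open>u\<close>. Both measurability and the independence from
  \<open>X u\<close> are read off from this form.\<close>

lemma mem_generation_iff:
  "u \<in> generation X n \<longleftrightarrow> length u = n \<and> (\<forall>k<n. u ! k < offspring_number X (take k u))"
proof (induction n arbitrary: u)
  case (Suc n)
  show ?case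
  proof (cases u rule: rev_cases)
    case (snoc v i)
    then show ?thesis
      by (auto simp: Suc.IH nth_append less_Suc_eq)
  qed simp
qed simp

lemma pred_mem_generation[measurable]: "Measurable.pred family_space (\<lambda>X. u \<in> generation X n)"
  unfolding mem_generation_iff by measurable

text \<open>Neither this membership nor the position of \<open>u\<close> reads \<open>X u\<close>;
  this is the independence of a particle from its own offspring that the branching step
  uses.\<close>

lemma generation_update: "length u = n \<Longrightarrow> u \<in> generation (X(u := y)) n \<longleftrightarrow> u \<in> generation X n"
  by (auto simp: mem_generation_iff offspring_number_def)

lemma position_update: "position (X(u := y)) u = position X u"
  unfolding position_def displacement_def by (intro sum.cong) auto

text \<open>Trades the random index set for a fixed countable one with a random weight, so that the
  sum can be exchanged with integrals.\<close>

lemma sum_generation: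
  fixes f :: "nat list \<Rightarrow> ennreal"
  shows "(\<Sum>u\<in>generation X n. f u) = (\<integral>\<^sup>+u. indicator (generation X n) u * f u \<partial>count_space UNIV)"
proof -
  have "(\<integral>\<^sup>+u. indicator (generation X n) u * f u \<partial>count_space UNIV)
      = (\<Sum>u\<in>generation X n. indicator (generation X n) u * f u)"
    by (rule nn_integral_count_space'[OF finite_generation]) auto
  also have "\<dots> = (\<Sum>u\<in>generation X n. f u)"
    by (intro sum.cong) auto
  finally show ?thesis by simp
qed

lemma sum_generation_Suc:
  "(\<Sum>u\<in>generation X (Suc n). f u) = (\<Sum>u\<in>generation X n. \<Sum>i<offspring_number X u. f (u @ [i]))"
proof -
  have "generation X (Suc n) = (\<lambda>(u, i). u @ [i]) ` (SIGMA u:generation X n. {..<offspring_number X u})"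
    by auto
  moreover have "inj_on (\<lambda>(u, i). u @ [i]) (SIGMA u:generation X n. {..<offspring_number X u})"
    by (auto simp: inj_on_def)
  ultimately have "(\<Sum>u\<in>generation X (Suc n). f u)
      = (\<Sum>(u, i)\<in>(SIGMA u:generation X n. {..<offspring_number X u}). f (u @ [i]))"
    by (simp add: sum.reindex case_prod_beta')
  also have "\<dots> = (\<Sum>u\<in>generation X n. \<Sum>i<offspring_number X u. f (u @ [i]))"
    by (rule sum.Sigma[symmetric]) (auto simp: finite_generation)
  finally show ?thesis .
qed

lemma measurable_pair_countable:
  assumes "\<And>u. (\<lambda>z. f z u) \<in> measurable M N"
  shows "(\<lambda>(z, u). f z u) \<in> measurable (M \<Otimes>\<^sub>M count_space (UNIV :: 'b :: countable set)) N"
proof -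
  have "(\<lambda>p. f (fst p) u) \<in> measurable (M \<Otimes>\<^sub>M count_space (UNIV :: 'b set)) N" for u
    by (rule measurable_compose[OF measurable_fst assms])
  from measurable_compose_countable[OF this measurable_snd]
  show ?thesis by (simp add: case_prod_beta')
qed

lemma measurable_sum_generation[measurable]:
  assumes [measurable]: "\<And>u. (\<lambda>X. f X u) \<in> borel_measurable family_space"
  shows "(\<lambda>X. \<Sum>u\<in>generation X n. f X u :: ennreal) \<in> borel_measurable family_space"
proof -
  have [measurable]: "(\<lambda>(X, u). indicator (generation X n) u * f X u)
      \<in> borel_measurable (family_space \<Otimes>\<^sub>M count_space UNIV)"
    by (rule measurable_pair_countable) (simp add: indicator_def)
  show ?thesis
    unfolding sum_generation
    by (rule sigma_finite_measure.borel_measurable_nn_integral[OF sigma_finite_measure_count_space])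
       measurable
qed

definition offspring_exp_sum :: "real \<Rightarrow> nat \<times> (nat \<Rightarrow> real) \<Rightarrow> ennreal" where
  "offspring_exp_sum t y = (\<Sum>i<fst y. ennreal (exp (t * snd y i)))"

lemma measurable_offspring_exp_sum[measurable]: "offspring_exp_sum t \<in> borel_measurable offspring_space"
proof -
  have "(\<lambda>y. \<Sum>i<n. ennreal (exp (t * snd y i))) \<in> borel_measurable offspring_space" for n
    by measurable
  then have "(\<lambda>y. (\<lambda>n y. \<Sum>i<n. ennreal (exp (t * snd y i))) (fst y) y) \<in> borel_measurable offspring_space"
    by (rule measurable_compose_countable) (rule measurable_fst_offspring)
  then show ?thesis by (simp add: offspring_exp_sum_def[abs_def])
qed

text \<open>In \<open>ennreal\<close> inversion is multiplicative only away from products of 0 and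
  \<infinity>, which the bounds on \<open>b\<close> exclude.\<close>

lemma prod_divide_ennreal:
  fixes a b :: "nat \<Rightarrow> ennreal"
  assumes "\<And>i. 0 < b i \<and> b i < \<infinity>"
  shows "(\<Prod>i<n. a i) / (\<Prod>i<n. b i) = (\<Prod>i<n. a i / b i)"
proof (induction n)
  case (Suc n)
  have "(\<Prod>i<n. b i) < \<infinity>"
    by (induction n) (use assms in \<open>auto simp: ennreal_mult_less_top\<close>)
  then have "(\<Prod>i<Suc n. a i) / (\<Prod>i<Suc n. b i) = ((\<Prod>i<n. a i) / (\<Prod>i<n. b i)) * (a n / b n)"
    using assms[of n] by (simp add: divide_ennreal_def ennreal_inverse_mult mult_ac)
  with Suc show ?case by simp
qed simp

section \<open>The quenched law and its Laplace transforms\<close>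

locale offspring_kernel =
  fixes \<Theta> :: "'e measure" and \<eta> :: "'e \<Rightarrow> (nat \<times> (nat \<Rightarrow> real)) measure"
  assumes kernel[measurable]: "\<eta> \<in> \<Theta> \<rightarrow>\<^sub>M prob_algebra offspring_space"
begin

abbreviation env_space :: "(nat \<Rightarrow> 'e) measure" where "env_space \<equiv> \<Pi>\<^sub>M n\<in>UNIV. \<Theta>"

text \<open>The counterpart of \<open>mgf0\<close> as a function of a single environment value, the
  form to which independence in time applies; \<open>mgf 0\<close> is the mean offspring
  number.\<close>

definition mgf :: "real \<Rightarrow> 'e \<Rightarrow> ennreal" where
  "mgf t x = (\<integral>\<^sup>+y. offspring_exp_sum t y \<partial>\<eta> x)"

lemma measurable_mgf[measurable]: "mgf t \<in> borel_measurable \<Theta>"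
  unfolding mgf_def[abs_def]
  by (rule measurable_compose[OF measurable_prob_algebraD[OF kernel]
        nn_integral_measurable_subprob_algebra]) measurable

lemma env_component: "e \<in> space env_space \<Longrightarrow> e k \<in> space \<Theta>"
  by (auto simp: space_PiM)

lemma prob_space_\<eta>: "x \<in> space \<Theta> \<Longrightarrow> prob_space (\<eta> x)"
  and sets_\<eta>: "x \<in> space \<Theta> \<Longrightarrow> sets (\<eta> x) = sets offspring_space"
  using measurable_space[OF kernel] by (auto simp: space_prob_algebra)

lemma sets_quenched: "e \<in> space env_space \<Longrightarrow> sets (quenched \<eta> e) = sets family_space"
  unfolding quenched_def family_space_def
  by (intro sets_PiM_cong) (auto simp: sets_\<eta> env_component)

lemma prob_space_quenched: "e \<in> space env_space \<Longrightarrow> prob_space (quenched \<eta> e)"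
  unfolding quenched_def by (intro prob_space_PiM prob_space_\<eta> env_component)

text \<open>Cylinder sets form an intersection-stable generator, and on each of them the product
  measure is a finite product of measurable functions of the environment. The integral formula for
  the mixture \<open>annealed\<close> rests on this.\<close>

lemma measurable_quenched: "quenched \<eta> \<in> env_space \<rightarrow>\<^sub>M prob_algebra family_space"
proof (rule measurable_prob_algebra_generated)
  show "sets family_space = sigma_sets (\<Pi>\<^sub>E u\<in>UNIV. space offspring_space)
      (prod_algebra (UNIV :: nat list set) (\<lambda>_. offspring_space))"
    unfolding family_space_def by (rule sets_PiM)
  show "Int_stable (prod_algebra (UNIV :: nat list set) (\<lambda>_. offspring_space))"
    by (rule Int_stable_prod_algebra)
  show "prod_algebra (UNIV :: nat list set) (\<lambda>_. offspring_space) \<subseteq> Pow (\<Pi>\<^sub>E u\<in>UNIV. space offspring_space)"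
    by (rule prod_algebra_sets_into_space)
next
  fix A assume "A \<in> prod_algebra (UNIV :: nat list set) (\<lambda>_. offspring_space)"
  then obtain J B where A: "A = prod_emb UNIV (\<lambda>_. offspring_space) J (\<Pi>\<^sub>E u\<in>J. B u)" "finite J"
    "\<And>u. u \<in> J \<Longrightarrow> B u \<in> sets offspring_space"
    by (elim prod_algebraE) auto
  have "emeasure (quenched \<eta> e) A = (\<Prod>u\<in>J. emeasure (\<eta> (e (length u))) (B u))"
    if e: "e \<in> space env_space" for e
  proof -
    \<comment> \<open>A cylinder depends on the factor measures only through their spaces, and these
      all equal that of \<open>offspring_space\<close>.\<close>
    have "A = prod_emb UNIV (\<lambda>u. \<eta> (e (length u))) J (\<Pi>\<^sub>E u\<in>J. B u)"
      using A(1) sets_eq_imp_space_eq[OF sets_\<eta>[OF env_component[OF e]]]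
      by (simp add: prod_emb_def)
    then show ?thesis
      unfolding quenched_def using A e
      by (simp add: emeasure_PiM_emb prob_space_\<eta> env_component sets_\<eta>)
  qed
  moreover have "(\<lambda>e. \<Prod>u\<in>J. emeasure (\<eta> (e (length u))) (B u)) \<in> borel_measurable env_space"
  proof (rule borel_measurable_prod_ennreal)
    fix u assume "u \<in> J"
    have "\<eta> \<in> \<Theta> \<rightarrow>\<^sub>M subprob_algebra offspring_space"
      by (rule measurable_prob_algebraD[OF kernel])
    then show "(\<lambda>e. emeasure (\<eta> (e (length u))) (B u)) \<in> borel_measurable env_space"
      using A(3)[OF \<open>u \<in> J\<close>]
      by (intro measurable_compose[OF _ measurable_emeasure_subprob_algebra]
          measurable_compose[OF measurable_component_singleton]) auto
  qed
  ultimately show "(\<lambda>e. emeasure (quenched \<eta> e) A) \<in> borel_measurable env_space"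
    by (simp cong: measurable_cong)
qed (simp_all add: sets_quenched prob_space_quenched)

lemma nn_integral_quenched_component:
  assumes e: "e \<in> space env_space" and [measurable]: "f \<in> borel_measurable offspring_space"
  shows "(\<integral>\<^sup>+X. f (X u) \<partial>quenched \<eta> e) = (\<integral>\<^sup>+y. f y \<partial>\<eta> (e (length u)))"
proof -
  have ps: "prob_space (\<eta> (e (length v)))" for v :: "nat list"
    by (intro prob_space_\<eta> env_component e)
  interpret product_prob_space "\<lambda>v :: nat list. \<eta> (e (length v))" UNIV
    by (intro product_prob_spaceI ps)
  have f: "f \<in> borel_measurable (\<eta> (e (length u)))"
    using measurable_cong_sets[OF sets_\<eta>[OF env_component[OF e]] refl] assms(2) by blast
  have "(\<integral>\<^sup>+y. f y \<partial>\<eta> (e (length u)))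
      = (\<integral>\<^sup>+y. f y \<partial>distr (quenched \<eta> e) (\<eta> (e (length u))) (\<lambda>X. X u))"
    using PiM_component[of u] by (simp add: quenched_def)
  also have "\<dots> = (\<integral>\<^sup>+X. f (X u) \<partial>quenched \<eta> e)"
    by (rule nn_integral_distr) (simp_all add: quenched_def f)
  finally show ?thesis by simp
qed

lemma mgf0_eq: "e \<in> space env_space \<Longrightarrow> mgf0 \<eta> e t = mgf t (e 0)"
  using nn_integral_quenched_component[of e "offspring_exp_sum t" "[]"]
  by (simp add: mgf0_def mgf_def offspring_exp_sum_def offspring_number_def displacement_def)

lemma mean0_eq: "e \<in> space env_space \<Longrightarrow> mean0 \<eta> e = mgf 0 (e 0)"
  by (simp flip: mgf0_zero add: mgf0_eq)

text \<open>The weight of \<open>u\<close> involves only its proper prefixes, so it is independent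
  of \<open>X u\<close>. All particles of one generation meet the same environment value
  \<open>e n\<close>, so the factor from the new generation does not depend on \<open>u\<close> and
  leaves the sum.\<close>

lemma quenched_exp_sum:
  assumes e: "e \<in> space env_space"
  shows "(\<integral>\<^sup>+X. (\<Sum>u\<in>generation X n. ennreal (exp (t * position X u))) \<partial>quenched \<eta> e)
    = (\<Prod>i<n. mgf t (e i))"
proof (induction n)
  case 0
  interpret prob_space "quenched \<eta> e" by (rule prob_space_quenched[OF e])
  show ?case by (simp add: position_Nil emeasure_space_1)
next
  case (Suc n)
  note [measurable_cong] = sets_quenched[OF e]
  let ?w = "\<lambda>X u. indicator (generation X n) u * ennreal (exp (t * position X u))"
  have w[measurable]: "(\<lambda>X. ?w X u) \<in> borel_measurable family_space" for u
    unfolding indicator_def by measurable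
  have exp_snoc: "(\<Sum>i<offspring_number X u. ennreal (exp (t * position X (u @ [i]))))
      = ennreal (exp (t * position X u)) * offspring_exp_sum t (X u)" for X u
    by (simp add: position_snoc offspring_exp_sum_def displacement_def offspring_number_def
        sum_distrib_left ring_distribs exp_add ennreal_mult' del: sum_ennreal)
  have "(\<integral>\<^sup>+X. (\<Sum>u\<in>generation X (Suc n). ennreal (exp (t * position X u))) \<partial>quenched \<eta> e)
      = (\<integral>\<^sup>+X. \<integral>\<^sup>+u. ?w X u * offspring_exp_sum t (X u) \<partial>count_space UNIV \<partial>quenched \<eta> e)"
    by (simp only: sum_generation_Suc exp_snoc) (simp only: sum_generation mult.assoc)
  also have "\<dots> = (\<integral>\<^sup>+u. \<integral>\<^sup>+X. ?w X u * offspring_exp_sum t (X u) \<partial>quenched \<eta> e \<partial>count_space UNIV)"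
    by (rule nn_integral_count_space_nn_integral) auto
  also have "\<dots> = (\<integral>\<^sup>+u. (\<integral>\<^sup>+X. ?w X u \<partial>quenched \<eta> e) * mgf t (e n) \<partial>count_space UNIV)"
  proof (intro nn_integral_cong)
    fix u
    show "(\<integral>\<^sup>+X. ?w X u * offspring_exp_sum t (X u) \<partial>quenched \<eta> e)
        = (\<integral>\<^sup>+X. ?w X u \<partial>quenched \<eta> e) * mgf t (e n)"
    proof (cases "length u = n")
      \<comment> \<open>Resampling \<open>X u\<close> leaves the weight \<open>?w\<close> unchanged,
        and the integrand becomes a product in separate variables. For any other length the weight
        is zero.\<close>
      case True
      have "(\<integral>\<^sup>+X. ?w X u * offspring_exp_sum t (X u) \<partial>quenched \<eta> e)
          = (\<integral>\<^sup>+y. \<integral>\<^sup>+X. ?w (X(u := y)) u * offspring_exp_sum t ((X(u := y)) u) \<partial>quenched \<eta> e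
              \<partial>\<eta> (e (length u)))"
        unfolding quenched_def
      proof (rule nn_integral_PiM_update)
        show "prob_space (\<eta> (e (length v)))" for v :: "nat list"
          by (intro prob_space_\<eta> env_component e)
        have "(\<lambda>X. ?w X u * offspring_exp_sum t (X u)) \<in> borel_measurable (quenched \<eta> e)"
          by measurable
        then show "(\<lambda>X. ?w X u * offspring_exp_sum t (X u))
            \<in> borel_measurable (\<Pi>\<^sub>M u\<in>UNIV. \<eta> (e (length u)))"
          by (simp add: quenched_def)
      qed
      also have "\<dots> = (\<integral>\<^sup>+y. \<integral>\<^sup>+X. ?w X u * offspring_exp_sum t y \<partial>quenched \<eta> e \<partial>\<eta> (e n))"
        using True by (simp add: indicator_def generation_update position_update)
      also have "\<dots> = (\<integral>\<^sup>+y. (\<integral>\<^sup>+X. ?w X u \<partial>quenched \<eta> e) * offspring_exp_sum t y \<partial>\<eta> (e n))"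
        by (intro nn_integral_cong nn_integral_multc) measurable
      also have "\<dots> = (\<integral>\<^sup>+X. ?w X u \<partial>quenched \<eta> e) * mgf t (e n)"
        unfolding mgf_def
        by (intro nn_integral_cmult)
           (simp add: measurable_cong_sets[OF sets_\<eta>[OF env_component[OF e]] refl])
      finally show ?thesis .
    next
      case False
      then have "u \<notin> generation X n" for X by (simp add: mem_generation_iff)
      then show ?thesis by simp
    qed
  qed
  also have "\<dots> = (\<integral>\<^sup>+u. \<integral>\<^sup>+X. ?w X u \<partial>quenched \<eta> e \<partial>count_space UNIV) * mgf t (e n)"
    by (rule nn_integral_multc) simp
  also have "(\<integral>\<^sup>+u. \<integral>\<^sup>+X. ?w X u \<partial>quenched \<eta> e \<partial>count_space UNIV)
      = (\<integral>\<^sup>+X. \<integral>\<^sup>+u. ?w X u \<partial>count_space UNIV \<partial>quenched \<eta> e)"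
    by (rule nn_integral_count_space_nn_integral[symmetric]) auto
  also have "\<dots> = (\<Prod>i<n. mgf t (e i))"
    by (simp only: Suc.IH flip: sum_generation)
  finally show ?case by simp
qed

lemma mean_count_eq: "e \<in> space env_space \<Longrightarrow> mean_count \<eta> e n = (\<Prod>i<n. mgf 0 (e i))"
  using quenched_exp_sum[where t = 0] by (simp add: mean_count_def point_count_def)

end

section \<open>Averaging over an i.i.d. environment\<close>

locale iid_environment = offspring_kernel +
  fixes Q
  assumes prob_space_Q: "prob_space Q" and sets_Q[measurable_cong]: "sets Q = sets \<Theta>"
begin

definition env_law :: "(nat \<Rightarrow> 'a) measure" where "env_law = (\<Pi>\<^sub>M n\<in>UNIV. Q)"

abbreviation annealed_law :: "((nat \<Rightarrow> 'a) \<times> family) measure" where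
  "annealed_law \<equiv> annealed \<Theta> env_law \<eta>"

lemma sets_env_law[measurable_cong]: "sets env_law = sets env_space"
  unfolding env_law_def by (intro sets_PiM_cong) (auto simp: sets_Q)

lemma space_env_law: "space env_law = space env_space"
  by (rule sets_eq_imp_space_eq[OF sets_env_law])

lemma AE_env_mean_pos_fin:
  assumes mean_pos_fin: "AE x in Q. 0 < mgf 0 x \<and> mgf 0 x < \<infinity>"
  shows "AE e in env_law. \<forall>i. 0 < mgf 0 (e i) \<and> mgf 0 (e i) < \<infinity>"
proof -
  interpret product_prob_space "\<lambda>_. Q" "UNIV :: nat set"
    by (intro product_prob_spaceI prob_space_Q)
  have "AE e in env_law. 0 < mgf 0 (e i) \<and> mgf 0 (e i) < \<infinity>" for i
  proof -
    have "distr env_law Q (\<lambda>e. e i) = Q"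
      using PiM_component[of i] by (simp add: env_law_def)
    then have "AE x in distr env_law Q (\<lambda>e. e i). 0 < mgf 0 x \<and> mgf 0 x < \<infinity>"
      using mean_pos_fin by (simp only:)
    then show ?thesis
      by (subst (asm) AE_distr_iff) (simp_all add: env_law_def)
  qed
  then show ?thesis by (simp add: AE_all_countable)
qed

lemma measurable_annealed_kernel:
  "(\<lambda>e. distr (quenched \<eta> e) (env_space \<Otimes>\<^sub>M family_space) (Pair e))
    \<in> env_law \<rightarrow>\<^sub>M subprob_algebra (env_space \<Otimes>\<^sub>M family_space)"
proof -
  have "(\<lambda>e. distr (quenched \<eta> e) (env_space \<Otimes>\<^sub>M family_space) (Pair e))
    \<in> env_space \<rightarrow>\<^sub>M subprob_algebra (env_space \<Otimes>\<^sub>M family_space)"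
    by (rule measurable_distr2[OF _ measurable_prob_algebraD[OF measurable_quenched]]) simp
  then show ?thesis
    by (simp add: measurable_cong_sets[OF sets_env_law refl])
qed

lemma env_space_not_empty: "space env_law \<noteq> {}"
proof -
  interpret prob_space env_law
    unfolding env_law_def by (intro prob_space_PiM prob_space_Q)
  show ?thesis by (rule not_empty)
qed

lemma sets_annealed_law[measurable_cong]: "sets annealed_law = sets (env_space \<Otimes>\<^sub>M family_space)"
  unfolding annealed_def by (rule sets_bind[OF _ env_space_not_empty]) simp

lemma nn_integral_annealed_law:
  assumes f[measurable]: "f \<in> borel_measurable (env_space \<Otimes>\<^sub>M family_space)"
  shows "(\<integral>\<^sup>+z. f z \<partial>annealed_law) = (\<integral>\<^sup>+e. \<integral>\<^sup>+X. f (e, X) \<partial>quenched \<eta> e \<partial>env_law)"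
  unfolding annealed_def nn_integral_bind[OF f measurable_annealed_kernel]
proof (intro nn_integral_cong nn_integral_distr)
  fix e assume "e \<in> space env_law"
  then have e: "e \<in> space env_space" by (simp add: space_env_law)
  then show "Pair e \<in> quenched \<eta> e \<rightarrow>\<^sub>M env_space \<Otimes>\<^sub>M family_space"
    by (simp add: measurable_cong_sets[OF sets_quenched[OF e] refl])
qed simp

lemma measurable_mean_count[measurable]: "(\<lambda>e. mean_count \<eta> e n) \<in> borel_measurable env_space"
proof -
  have "(\<lambda>e. \<Prod>i<n. mgf 0 (e i)) \<in> borel_measurable env_space" by measurable
  then show ?thesis by (simp add: mean_count_eq cong: measurable_cong)
qed

text \<open>The sequence \<open>u\<close> ranges over all finite sequences under counting measure,
  and membership in the generation enters as a density. In this form countable additivity comes for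
  free, and integrals reduce to Tonelli.\<close>

definition \<mu> :: "nat \<Rightarrow> real measure" where
  "\<mu> n = distr
     (density (annealed_law \<Otimes>\<^sub>M count_space UNIV) (\<lambda>((e, X), u). indicator (generation X n) u / mean_count \<eta> e n))
     borel (\<lambda>((e, X), u). position X u / real n)"

lemma nn_integral_\<mu>:
  assumes [measurable]: "f \<in> borel_measurable borel"
  shows "(\<integral>\<^sup>+x. f x \<partial>\<mu> n)
    = (\<integral>\<^sup>+(e, X). (\<Sum>u\<in>generation X n. f (position X u / real n)) / mean_count \<eta> e n \<partial>annealed_law)"
proof -
  have pos[measurable]: "(\<lambda>((e, X), u). position X u / real n)
      \<in> borel_measurable (annealed_law \<Otimes>\<^sub>M count_space UNIV)"
    using measurable_pair_countable[of "\<lambda>(e, X) u. position X u / real n" annealed_law borel]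
    by (simp add: case_prod_beta')
  have wgt[measurable]: "(\<lambda>((e, X), u). indicator (generation X n) u / mean_count \<eta> e n)
      \<in> borel_measurable (annealed_law \<Otimes>\<^sub>M count_space UNIV)"
    using measurable_pair_countable[of
        "\<lambda>(e, X) u. indicator (generation X n) u / mean_count \<eta> e n" annealed_law borel]
    by (simp add: case_prod_beta' indicator_def)
  interpret count: sigma_finite_measure "count_space (UNIV :: nat list set)"
    by (rule sigma_finite_measure_count_space)
  have "(\<integral>\<^sup>+x. f x \<partial>\<mu> n) = (\<integral>\<^sup>+z. (case z of ((e, X), u) \<Rightarrow> indicator (generation X n) u / mean_count \<eta> e n)
      * f (case z of ((e, X), u) \<Rightarrow> position X u / real n) \<partial>(annealed_law \<Otimes>\<^sub>M count_space UNIV))"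
    unfolding \<mu>_def by (subst nn_integral_distr, simp, simp, subst nn_integral_density)
       (simp_all add: case_prod_beta')
  also have "\<dots> = (\<integral>\<^sup>+p. \<integral>\<^sup>+u. (case (p, u) of ((e, X), u) \<Rightarrow> indicator (generation X n) u / mean_count \<eta> e n)
      * f (case (p, u) of ((e, X), u) \<Rightarrow> position X u / real n) \<partial>count_space UNIV \<partial>annealed_law)"
    by (rule count.nn_integral_fst[symmetric]) measurable
  also have "\<dots> = (\<integral>\<^sup>+(e, X). (\<Sum>u\<in>generation X n. f (position X u / real n)) / mean_count \<eta> e n \<partial>annealed_law)"
  proof (intro nn_integral_cong)
    fix p :: "(nat \<Rightarrow> 'a) \<times> family"
    obtain e X where p: "p = (e, X)" by (cases p)
    have "(\<integral>\<^sup>+u. indicator (generation X n) u / mean_count \<eta> e n * f (position X u / real n) \<partial>count_space UNIV)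
        = (\<integral>\<^sup>+u. indicator (generation X n) u * f (position X u / real n) / mean_count \<eta> e n \<partial>count_space UNIV)"
      by (simp add: divide_ennreal_def mult.assoc mult.commute mult.left_commute)
    also have "\<dots> = (\<Sum>u\<in>generation X n. f (position X u / real n)) / mean_count \<eta> e n"
      unfolding sum_generation by (rule nn_integral_divide) simp
    finally show "(\<integral>\<^sup>+u. (case (p, u) of ((e, X), u) \<Rightarrow> indicator (generation X n) u / mean_count \<eta> e n)
      * f (case (p, u) of ((e, X), u) \<Rightarrow> position X u / real n) \<partial>count_space UNIV)
      = (case p of (e, X) \<Rightarrow> (\<Sum>u\<in>generation X n. f (position X u / real n)) / mean_count \<eta> e n)"
      by (simp add: p)
  qed
  finally show ?thesis .
qed

lemma sets_\<mu>: "sets (\<mu> n) = sets borel"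
  by (simp add: \<mu>_def)

text \<open>Multiplication by n is inverted by division only for n \<ge> 1; for n = 0 the image of a
  nonempty set collapses to the origin.\<close>

lemma scaled_mean_eq:
  assumes n: "1 \<le> n" and A: "A \<in> sets borel"
  shows "scaled_mean annealed_law \<eta> n A = emeasure (\<mu> n) A"
proof -
  have "s \<in> (\<lambda>x. real n * x) ` A \<longleftrightarrow> s / real n \<in> A" for s
    using n by (auto simp: image_iff intro!: bexI[of _ "s / real n"])
  then have "point_count X n ((\<lambda>x. real n * x) ` A)
      = (\<Sum>u\<in>generation X n. indicator A (position X u / real n))" for X
    unfolding point_count_def indicator_def by simp
  then have "scaled_mean annealed_law \<eta> n A = (\<integral>\<^sup>+x. indicator A x \<partial>\<mu> n)"
    using A by (simp add: scaled_mean_def nn_integral_\<mu>)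
  then show ?thesis using A by (simp add: sets_\<mu>)
qed

lemma laplace_\<mu>:
  assumes mean_pos_fin: "AE x in Q. 0 < mgf 0 x \<and> mgf 0 x < \<infinity>" and n: "1 \<le> n"
  shows "(\<integral>\<^sup>+x. ennreal (exp (real n * t * x)) \<partial>\<mu> n) = (\<integral>\<^sup>+x. mgf t x / mgf 0 x \<partial>Q) ^ n"
proof -
  have [measurable]: "(\<lambda>X. \<Sum>u\<in>generation X n. ennreal (exp (t * position X u)))
      \<in> borel_measurable family_space"
    by (rule measurable_sum_generation) measurable
  have "real n * t * (s / real n) = t * s" for s
    using n by simp
  then have "(\<integral>\<^sup>+x. ennreal (exp (real n * t * x)) \<partial>\<mu> n)
      = (\<integral>\<^sup>+(e, X). (\<Sum>u\<in>generation X n. ennreal (exp (t * position X u))) / mean_count \<eta> e n \<partial>annealed_law)"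
    by (simp add: nn_integral_\<mu> del: sum_ennreal)
  also have "\<dots> = (\<integral>\<^sup>+e. \<integral>\<^sup>+X. (\<Sum>u\<in>generation X n. ennreal (exp (t * position X u))) / mean_count \<eta> e n
      \<partial>quenched \<eta> e \<partial>env_law)"
    by (subst nn_integral_annealed_law) (simp_all del: sum_ennreal)
  also have "\<dots> = (\<integral>\<^sup>+e. (\<Prod>i<n. mgf t (e i)) / (\<Prod>i<n. mgf 0 (e i)) \<partial>env_law)"
  proof (intro nn_integral_cong)
    fix e assume "e \<in> space env_law"
    then have e: "e \<in> space env_space" by (simp add: space_env_law)
    note [measurable_cong] = sets_quenched[OF e]
    show "(\<integral>\<^sup>+X. (\<Sum>u\<in>generation X n. ennreal (exp (t * position X u))) / mean_count \<eta> e n \<partial>quenched \<eta> e)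
        = (\<Prod>i<n. mgf t (e i)) / (\<Prod>i<n. mgf 0 (e i))"
      by (subst nn_integral_divide) (simp_all add: quenched_exp_sum[OF e] mean_count_eq[OF e] del: sum_ennreal)
  qed
  \<comment> \<open>For almost every environment all means are positive and finite, so the quotient
    of products may be split into factors depending on one environment value each.\<close>
  also have "\<dots> = (\<integral>\<^sup>+e. (\<Prod>i<n. mgf t (e i) / mgf 0 (e i)) \<partial>env_law)"
    using AE_env_mean_pos_fin[OF mean_pos_fin] by (intro nn_integral_cong_AE) (auto simp: prod_divide_ennreal)
  also have "\<dots> = (\<integral>\<^sup>+x. mgf t x / mgf 0 x \<partial>Q) ^ n"
    unfolding env_law_def by (rule nn_integral_PiM_prod[OF prob_space_Q]) measurable
  finally show ?thesis .
qed

lemma nn_integral_annealed_law_first: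
  assumes g[measurable]: "g \<in> borel_measurable \<Theta>"
  shows "(\<integral>\<^sup>+p. g (fst p 0) \<partial>annealed_law) = (\<integral>\<^sup>+x. g x \<partial>Q)"
proof -
  have "(\<integral>\<^sup>+p. g (fst p 0) \<partial>annealed_law) = (\<integral>\<^sup>+e. g (e 0) \<partial>env_law)"
  proof (subst nn_integral_annealed_law, measurable, intro nn_integral_cong)
    fix e assume "e \<in> space env_law"
    then interpret prob_space "quenched \<eta> e"
      by (intro prob_space_quenched) (simp add: space_env_law)
    show "(\<integral>\<^sup>+X. g (fst (e, X) 0) \<partial>quenched \<eta> e) = g (e 0)"
      by (simp add: emeasure_space_1)
  qed
  \<comment> \<open>Seen as a product with one factor, the integral is the case n = 1 of the product
    formula.\<close>
  also have "\<dots> = (\<integral>\<^sup>+e. (\<Prod>i<1. g (e i)) \<partial>env_law)"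
    by simp
  also have "\<dots> = (\<integral>\<^sup>+x. g x \<partial>Q) ^ 1"
    unfolding env_law_def by (rule nn_integral_PiM_prod[OF prob_space_Q]) measurable
  finally show ?thesis by simp
qed

lemma fst_in_env_space: "p \<in> space annealed_law \<Longrightarrow> fst p \<in> space env_space"
  using sets_eq_imp_space_eq[OF sets_annealed_law] by (auto simp: space_pair_measure)

text \<open>Integrating the indicator of the exceptional set carries the statement over: its
  annealed integral vanishes and equals the \<open>Q\<close>-mass of that set.\<close>

lemma AE_mean_pos_fin:
  assumes "AE (e, X) in annealed_law. 0 < mean0 \<eta> e \<and> mean0 \<eta> e < \<infinity>"
  shows "AE x in Q. 0 < mgf 0 x \<and> mgf 0 x < \<infinity>"
proof -
  define B where "B = {x \<in> space \<Theta>. \<not> (0 < mgf 0 x \<and> mgf 0 x < \<infinity>)}"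
  have [measurable]: "B \<in> sets \<Theta>" unfolding B_def by measurable
  have "AE p in annealed_law. indicator B (fst p 0) = (0 :: ennreal)"
    using assms AE_space
  proof eventually_elim
    case (elim p)
    then have "mean0 \<eta> (fst p) = mgf 0 (fst p 0)"
      by (simp add: mean0_eq fst_in_env_space)
    with elim show ?case by (auto simp: B_def case_prod_beta' indicator_def)
  qed
  then have "(\<integral>\<^sup>+p. indicator B (fst p 0) \<partial>annealed_law) = (\<integral>\<^sup>+p. 0 \<partial>annealed_law)"
    by (rule nn_integral_cong_AE)
  then have "(\<integral>\<^sup>+x. indicator B x \<partial>Q) = 0"
    by (simp add: nn_integral_annealed_law_first)
  then have "AE x in Q. indicator B x = (0 :: ennreal)"
    by (subst (asm) nn_integral_0_iff_AE) auto
  then show ?thesis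
    using AE_space
    by eventually_elim
       (auto simp: B_def indicator_def sets_eq_imp_space_eq[OF sets_Q] zero_less_iff_neq_zero
          split: if_splits)
qed

lemma mean_mgf_ratio:
  "(\<integral>\<^sup>+(e, X). mgf0 \<eta> e t / mean0 \<eta> e \<partial>annealed_law) = (\<integral>\<^sup>+x. mgf t x / mgf 0 x \<partial>Q)"
proof -
  have "(\<integral>\<^sup>+(e, X). mgf0 \<eta> e t / mean0 \<eta> e \<partial>annealed_law) = (\<integral>\<^sup>+p. mgf t (fst p 0) / mgf 0 (fst p 0) \<partial>annealed_law)"
    by (intro nn_integral_cong) (simp add: case_prod_beta' mgf0_eq mean0_eq fst_in_env_space)
  also have "\<dots> = (\<integral>\<^sup>+x. mgf t x / mgf 0 x \<partial>Q)"
    by (rule nn_integral_annealed_law_first) measurable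
  finally show ?thesis .
qed

text \<open>In \<open>ennreal\<close> both \<open>0 / 0\<close> and
  \<open>\<infinity> / \<infinity>\<close> are 0, so the ratio is 1 only where the mean is positive
  and finite.\<close>

lemma mean_mgf_ratio_zero:
  assumes mean_pos_fin: "AE x in Q. 0 < mgf 0 x \<and> mgf 0 x < \<infinity>"
  shows "(\<integral>\<^sup>+x. mgf 0 x / mgf 0 x \<partial>Q) = 1"
proof -
  interpret prob_space Q by (rule prob_space_Q)
  have "(\<integral>\<^sup>+x. mgf 0 x / mgf 0 x \<partial>Q) = (\<integral>\<^sup>+x. 1 \<partial>Q)"
    using mean_pos_fin by (intro nn_integral_cong_AE) auto
  then show ?thesis by (simp add: emeasure_space_1)
qed

lemma measure_space_scaled_mean:
  assumes "1 \<le> n"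
  shows "measure_space UNIV (sets borel) (scaled_mean annealed_law \<eta> n)"
proof -
  have "measure_space UNIV (sets borel) (emeasure (\<mu> n))"
    using measure_space[of "\<mu> n"] sets_eq_imp_space_eq[OF sets_\<mu>] by (simp add: sets_\<mu>)
  then show ?thesis
    using measure_space_eq[of "sets borel" UNIV "scaled_mean annealed_law \<eta> n" "emeasure (\<mu> n)"] assms
    by (simp add: scaled_mean_eq sets.sigma_sets_eq[where M=borel, simplified])
qed

end

theorem theorem2p3:
  fixes M :: "'w measure" and \<Theta> :: "'e measure"
    and \<xi> :: "nat \<Rightarrow> 'w \<Rightarrow> 'e"
    and \<eta> :: "'e \<Rightarrow> (nat \<times> (nat \<Rightarrow> real)) measure"
    and P :: "((nat \<Rightarrow> 'e) \<times> family) measure"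
  assumes env: "prob_space M"
    and indep: "prob_space.indep_vars M (\<lambda>_. \<Theta>) \<xi> UNIV"
    and ident: "\<And>n. distr M \<Theta> (\<xi> n) = distr M \<Theta> (\<xi> 0)"
    and kernel: "\<eta> \<in> \<Theta> \<rightarrow>\<^sub>M prob_algebra offspring_space"
    and P: "P = annealed \<Theta> (environment_law M \<Theta> \<xi>) \<eta>"
    and mean0_pos_fin: "AE (e, X) in P. 0 < mean0 \<eta> e \<and> mean0 \<eta> e < \<infinity>"
    and log_mean0_integrable: "integrable P (\<lambda>(e, X). ln (enn2real (mean0 \<eta> e)))"
    and supercritical: "0 < (\<integral>(e, X). ln (enn2real (mean0 \<eta> e)) \<partial>P)"
    and NlogN: "(\<integral>\<^sup>+ (e, X). of_nat (offspring_number X []) / mean0 \<eta> e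
                     * ennreal (log_plus (real (offspring_number X []))) \<partial>P) < \<infinity>"
    and mgf: "\<And>t::real. 0 < (\<integral>\<^sup>+ (e, X). mgf0 \<eta> e t / mean0 \<eta> e \<partial>P)
                     \<and> (\<integral>\<^sup>+ (e, X). mgf0 \<eta> e t / mean0 \<eta> e \<partial>P) < \<infinity>"
  shows "(\<forall>n\<ge>1. measure_space UNIV (sets borel) (scaled_mean P \<eta> n) \<and> scaled_mean P \<eta> n UNIV < \<infinity>)
    \<and> rate_function (legendre (log_laplace P \<eta>))
    \<and> (\<forall>A\<in>sets (borel :: real measure).
         - (INF x\<in>interior A. legendre (log_laplace P \<eta>) x)
           \<le> liminf (\<lambda>n. ereal (1 / real n) * ext_log (scaled_mean P \<eta> n A))
       \<and> liminf (\<lambda>n. ereal (1 / real n) * ext_log (scaled_mean P \<eta> n A))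
           \<le> limsup (\<lambda>n. ereal (1 / real n) * ext_log (scaled_mean P \<eta> n A))
       \<and> limsup (\<lambda>n. ereal (1 / real n) * ext_log (scaled_mean P \<eta> n A))
           \<le> - (INF x\<in>closure A. legendre (log_laplace P \<eta>) x))"
proof -
  interpret prob_space M by (rule env)
  have rv: "\<xi> n \<in> M \<rightarrow>\<^sub>M \<Theta>" for n
    using indep by (auto simp: indep_vars_def)
  interpret iid_environment \<Theta> \<eta> "distr M \<Theta> (\<xi> 0)"
    by (intro iid_environment.intro offspring_kernel.intro iid_environment_axioms.intro
        kernel prob_space_distr rv) simp
  \<comment> \<open>Independence turns the joint law into a product, and equal marginals make every
    factor the law of \<open>\<xi> 0\<close>.\<close>
  have "environment_law M \<Theta> \<xi> = (\<Pi>\<^sub>M n\<in>UNIV. distr M \<Theta> (\<xi> n))"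
    using indep indep_vars_iff_distr_eq_PiM'[of UNIV \<xi> "\<lambda>_. \<Theta>"] rv
    by (simp add: environment_law_def restrict_UNIV)
  also have "\<dots> = env_law"
    unfolding env_law_def by (intro PiM_cong ident refl)
  finally have P_eq: "P = annealed \<Theta> env_law \<eta>" by (simp add: P)
  note pos_fin = AE_mean_pos_fin[OF mean0_pos_fin[unfolded P_eq]]
  define m where "m t = enn2real (\<integral>\<^sup>+(e, X). mgf0 \<eta> e t / mean0 \<eta> e \<partial>P)" for t
  have m: "(\<integral>\<^sup>+(e, X). mgf0 \<eta> e t / mean0 \<eta> e \<partial>P) = ennreal (m t)" "0 < m t" for t
    using mgf[of t] by (auto simp: m_def enn2real_positive_iff)
  interpret laplace_sequence \<mu> m
  proof
    show "m 0 = 1"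
      using mean_mgf_ratio_zero[OF pos_fin] by (simp add: m_def P_eq mean_mgf_ratio)
    show "(\<integral>\<^sup>+x. ennreal (exp (real n * t * x)) \<partial>\<mu> n) = ennreal (m t ^ n)" if "1 \<le> n" for n t
      using laplace_\<mu>[OF pos_fin that] m[of t] by (simp add: P_eq mean_mgf_ratio ennreal_power)
  qed (simp_all add: sets_\<mu> m)
  have log_laplace_eq: "log_laplace P \<eta> = (\<lambda>t. ereal (\<Lambda> t))"
    using m by (auto simp: log_laplace_def ext_log_ennreal \<Lambda>_def)
  \<comment> \<open>The Laplace transform at t = 0 is the total mass.\<close>
  have "scaled_mean P \<eta> n UNIV < \<infinity>" if "1 \<le> n" for n
    using laplace[OF that, of 0] that
    by (simp add: P_eq scaled_mean_eq M_zero sets_eq_imp_space_eq[OF sets_\<mu>])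
  moreover have "measure_space UNIV (sets borel) (scaled_mean P \<eta> n)" if "1 \<le> n" for n
    using that by (simp add: P_eq measure_space_scaled_mean)
  moreover have "- (INF x\<in>interior A. rate x) \<le> liminf (\<lambda>n. ereal (1 / real n) * ext_log (scaled_mean P \<eta> n A))"
    "limsup (\<lambda>n. ereal (1 / real n) * ext_log (scaled_mean P \<eta> n A)) \<le> - (INF x\<in>closure A. rate x)"
    if A: "A \<in> sets borel" for A
  proof -
    \<comment> \<open>The two sequences are compared from index 1 on, which is enough for liminf and
      limsup.\<close>
    have ev: "eventually (\<lambda>n. ereal (1 / real n) * ext_log (scaled_mean P \<eta> n A)
        = ereal (1 / real n) * ext_log (emeasure (\<mu> n) A)) sequentially"
      using eventually_ge_at_top[of 1] by eventually_elim (simp add: P_eq scaled_mean_eq A)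
    show "- (INF x\<in>interior A. rate x) \<le> liminf (\<lambda>n. ereal (1 / real n) * ext_log (scaled_mean P \<eta> n A))"
      using large_deviation_principle(1)[OF A] Liminf_eq[OF ev] by simp
    show "limsup (\<lambda>n. ereal (1 / real n) * ext_log (scaled_mean P \<eta> n A)) \<le> - (INF x\<in>closure A. rate x)"
      using large_deviation_principle(2)[OF A] Limsup_eq[OF ev] by simp
  qed
  ultimately show ?thesis
    using rate_function_rate by (simp add: log_laplace_eq Liminf_le_Limsup)
qed

end
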